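(* Let $\mathcal{P}$ be a homogeneous Poisson point process of rate $1$ in the upper half-plane $\mathbb{R}\times[0,\infty)$. There exist two $\mathcal{P}$-almost surely distinct random trees $T=T(\mathcal{P})$ and $T'=T'(\mathcal{P})$ (deterministic functions of $\mathcal{P}$) with vertex set $\mathbb{Z}$ such that: (a) almost surely, in $T$ there is a unique infinite rightward path from each vertex; (b) almost surely, in $T'$ there is a unique infinite leftward path from each vertex; (c) neither $T$ nor $T'$ is a factor of the other. Furthermore, for $U=T$ and for $U=T'$: (d) for any $n\in\mathbb{Z}$, $U(\mathcal{P}+n)=U(\mathcal{P})+n$; (e) for any $n\in\mathbb{Z}$, $U^{(n)}$ is distributed as $\mathcal{T}_{\mathrm{IIC}}$ (in the local weak sense).
   Context: A rightward (leftward) path is one along which the integer labels of the vertices increase (decrease). A random variable $X$ is a factor of a random variable $Y$ if almost surely $X=f(Y)$ for some deterministic function $f$. For a point set $P\subset\mathbb{R}^2$ and $n\in\mathbb{Z}$, $P+n=\{(x+n,y):(x,y)\in P\}$; for a graph $U$ on $\mathbb{Z}$, $U+n$ is the graph obtained by replacing each vertex $i$ by $i+n$. $U^{(n)}$ denotes $U$ rooted at the vertex $n$. $\mathrm{PGW}(1)$ denotes a Galton–Watson tree with Poisson$(1)$ offspring distribution. The Poisson incipient infinite cluster $\mathcal{T}_{\mathrm{IIC}}$ is the random rooted infinite tree obtained by starting from a single one-way infinite path and making each node of the path the root of an independent copy of $\mathrm{PGW}(1)$; it is rooted at the starting vertex of the path. Two rooted random graphs have the same distribution in the local weak sense if, for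 every finite $r$, the $r$-neighborhoods of their roots have the same distribution (up to rooted isomorphism; vertex labels and edge weights are ignored). *)

theory Defs
  imports "HOL-Probability.Probability"
begin

section \<open>Homogeneous Poisson point processes\<close>

definition configurations :: "'b::euclidean_space set \<Rightarrow> 'b set set" where
  "configurations D = {C. C \<subseteq> D \<and> (\<forall>B. bounded B \<longrightarrow> finite (C \<inter> B))}"

definition config_space :: "'b::euclidean_space set \<Rightarrow> 'b set measure" where
  "config_space D = sigma (configurations D)
     {{C \<in> configurations D. card (C \<inter> B) = k} | B k. B \<in> sets borel \<and> bounded B}"

text \<open>The formula for the point probabilities below also covers null sets \<open>B\<close>, because \<open>0 ^ 0 = 1\<close>;
  the library's \<open>poisson_pmf\<close> is specified only for positive rates.\<close>

definition poisson_process ::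
    "'a measure \<Rightarrow> real \<Rightarrow> 'b::euclidean_space set \<Rightarrow> ('a \<Rightarrow> 'b set) \<Rightarrow> bool" where
  "poisson_process M rate D N \<longleftrightarrow>
     N \<in> M \<rightarrow>\<^sub>M config_space D \<and>
     (\<forall>B k. B \<in> sets borel \<longrightarrow> bounded B \<longrightarrow> B \<subseteq> D \<longrightarrow>
        measure M {\<omega> \<in> space M. card (N \<omega> \<inter> B) = k} =
          exp (- (rate * measure lborel B)) * (rate * measure lborel B) ^ k / fact k) \<and>
     (\<forall>(I :: nat set) B. finite I \<longrightarrow>
        (\<forall>i\<in>I. B i \<in> sets borel \<and> bounded (B i) \<and> B i \<subseteq> D) \<longrightarrow> disjoint_family_on B I \<longrightarrow>
        prob_space.indep_vars M (\<lambda>_. count_space UNIV) (\<lambda>i \<omega>. card (N \<omega> \<inter> B i)) I)"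

definition half_plane :: "(real \<times> real) set" where
  "half_plane = UNIV \<times> {0..}"

definition shift_points :: "int \<Rightarrow> (real \<times> real) set \<Rightarrow> (real \<times> real) set" where
  "shift_points n C = (\<lambda>(x, y). (x + of_int n, y)) ` C"


section \<open>Simple undirected graphs and trees\<close>

record 'v graph =
  verts :: "'v set"
  edges :: "'v set set"

definition simple_graph :: "'v graph \<Rightarrow> bool" where
  "simple_graph G \<longleftrightarrow> (\<forall>e \<in> edges G. \<exists>u v. u \<in> verts G \<and> v \<in> verts G \<and> u \<noteq> v \<and> e = {u, v})"

definition walk :: "'v graph \<Rightarrow> 'v list \<Rightarrow> bool" where
  "walk G xs \<longleftrightarrow> xs \<noteq> [] \<and> set xs \<subseteq> verts G \<and> successively (\<lambda>u v. {u, v} \<in> edges G) xs"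

definition is_connected :: "'v graph \<Rightarrow> bool" where
  "is_connected G \<longleftrightarrow>
     verts G \<noteq> {} \<and> (\<forall>u \<in> verts G. \<forall>v \<in> verts G. \<exists>xs. walk G xs \<and> hd xs = u \<and> last xs = v)"

definition is_cycle :: "'v graph \<Rightarrow> 'v list \<Rightarrow> bool" where
  "is_cycle G xs \<longleftrightarrow> walk G xs \<and> distinct xs \<and> length xs \<ge> 3 \<and> {last xs, hd xs} \<in> edges G"

definition is_tree :: "'v graph \<Rightarrow> bool" where
  "is_tree G \<longleftrightarrow> simple_graph G \<and> is_connected G \<and> (\<nexists>xs. is_cycle G xs)"

definition infinite_path_from :: "'v graph \<Rightarrow> 'v \<Rightarrow> (nat \<Rightarrow> 'v) \<Rightarrow> bool" where
  "infinite_path_from G v p \<longleftrightarrow>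
     p 0 = v \<and> inj p \<and> range p \<subseteq> verts G \<and> (\<forall>k. {p k, p (Suc k)} \<in> edges G)"

definition rightward :: "(nat \<Rightarrow> int) \<Rightarrow> bool" where
  "rightward p \<longleftrightarrow> (\<forall>k. p k < p (Suc k))"

definition leftward :: "(nat \<Rightarrow> int) \<Rightarrow> bool" where
  "leftward p \<longleftrightarrow> (\<forall>k. p (Suc k) < p k)"

definition shift_graph :: "int \<Rightarrow> int graph \<Rightarrow> int graph" where
  "shift_graph n G = \<lparr>verts = (\<lambda>i. i + n) ` verts G, edges = (\<lambda>e. (\<lambda>i. i + n) ` e) ` edges G\<rparr>"


section \<open>Random graphs with vertex set the integers\<close>

definition int_graphs :: "int graph set" where
  "int_graphs = {G. verts G = UNIV \<and> simple_graph G}"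

definition int_graph_space :: "int graph measure" where
  "int_graph_space = sigma int_graphs {{G \<in> int_graphs. {i, j} \<in> edges G} | i j. True}"

definition is_factor_of ::
    "'a measure \<Rightarrow> 'c measure \<Rightarrow> ('a \<Rightarrow> 'c) \<Rightarrow> 'd measure \<Rightarrow> ('a \<Rightarrow> 'd) \<Rightarrow> bool" where
  "is_factor_of M S X R Y \<longleftrightarrow> (\<exists>f \<in> R \<rightarrow>\<^sub>M S. AE \<omega> in M. X \<omega> = f (Y \<omega>))"


section \<open>Rooted graphs and local weak equality in distribution\<close>

type_synonym 'v rooted_graph = "'v graph \<times> 'v"

definition rooted_iso :: "'v rooted_graph \<Rightarrow> 'w rooted_graph \<Rightarrow> bool" where
  "rooted_iso = (\<lambda>(G, a) (H, b). \<exists>\<phi>. bij_betw \<phi> (verts G) (verts H) \<and> \<phi> a = b \<and>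
     (\<forall>u \<in> verts G. \<forall>v \<in> verts G. {u, v} \<in> edges G \<longleftrightarrow> {\<phi> u, \<phi> v} \<in> edges H))"

definition ball_verts :: "nat \<Rightarrow> 'v rooted_graph \<Rightarrow> 'v set" where
  "ball_verts r = (\<lambda>(G, a). {v. \<exists>xs. walk G xs \<and> hd xs = a \<and> last xs = v \<and> length xs \<le> Suc r})"

definition neighborhood :: "nat \<Rightarrow> 'v rooted_graph \<Rightarrow> 'v rooted_graph" where
  "neighborhood r = (\<lambda>(G, a).
     (\<lparr>verts = ball_verts r (G, a), edges = {e \<in> edges G. e \<subseteq> ball_verts r (G, a)}\<rparr>, a))"

text \<open>There are countably many finite rooted graphs up to isomorphism, each represented by
  one on a finite set of natural numbers; so the law of an almost surely finite random
  neighborhood is determined by the point probabilities of these isomorphism classes.\<close>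

definition same_local_law ::
    "'a measure \<Rightarrow> ('a \<Rightarrow> 'v rooted_graph) \<Rightarrow> 'b measure \<Rightarrow> ('b \<Rightarrow> 'w rooted_graph) \<Rightarrow> bool" where
  "same_local_law M X N Y \<longleftrightarrow>
     (\<forall>r (H :: nat graph) a. finite (verts H) \<longrightarrow> simple_graph H \<longrightarrow> a \<in> verts H \<longrightarrow>
        measure M {\<omega> \<in> space M. rooted_iso (neighborhood r (X \<omega>)) (H, a)} =
        measure N {\<eta> \<in> space N. rooted_iso (neighborhood r (Y \<eta>)) (H, a)})"


section \<open>The Poisson incipient infinite cluster\<close>

text \<open>Ulam--Harris encoding: the children of the node \<open>u\<close> are \<open>u @ [i]\<close> with \<open>i < c u\<close>,
  where \<open>c u\<close> is the number of offspring of \<open>u\<close>.\<close>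

definition gw_tree :: "(nat list \<Rightarrow> nat) \<Rightarrow> nat list graph" where
  "gw_tree c =
     (let V = {u. \<forall>k < length u. u ! k < c (take k u)}
      in \<lparr>verts = V, edges = {{u, u @ [i]} | u i. u @ [i] \<in> V}\<rparr>)"

definition pgw_measure :: "(nat list \<Rightarrow> nat) measure" where
  "pgw_measure = Pi\<^sub>M UNIV (\<lambda>_. measure_pmf (poisson_pmf 1))"

text \<open>The \<open>n\<close>-th node of the infinite path is \<open>(n, [])\<close>, and the nodes \<open>(n, u)\<close> form the tree
  hanging off it.\<close>

definition iic_tree :: "(nat \<Rightarrow> nat list \<Rightarrow> nat) \<Rightarrow> (nat \<times> nat list) graph" where
  "iic_tree c =
     \<lparr>verts = {(n, u). u \<in> verts (gw_tree (c n))},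
      edges = {{(n, u), (n, v)} | n u v. {u, v} \<in> edges (gw_tree (c n))} \<union>
              {{(n, []), (Suc n, [])} | n. True}\<rparr>"

definition iic_rooted :: "(nat \<Rightarrow> nat list \<Rightarrow> nat) \<Rightarrow> (nat \<times> nat list) rooted_graph" where
  "iic_rooted c = (iic_tree c, (0, []))"

definition iic_measure :: "(nat \<Rightarrow> nat list \<Rightarrow> nat) measure" where
  "iic_measure = Pi\<^sub>M UNIV (\<lambda>_. pgw_measure)"

end

theory Submission
  imports Defs
begin

text \<open>The numbers of points in the unit boxes above \<open>[i, i + 1)\<close> are i.i.d. Poisson variables
  \<open>\<xi> i\<close>. Let the parent of \<open>u\<close> be the first \<open>w > u\<close> with \<open>(\<Sum>i\<in>{u<..w}. \<xi> i - 1) \<ge> 0\<close>. The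
  descendants of \<open>v\<close> form an interval ending in \<open>v\<close>, and reading \<open>\<xi>\<close> leftwards from \<open>v\<close> gives the
  offspring numbers of this plane tree in preorder; so its law is \<open>PGW(1)\<close>. The tree of descendants of
  the \<open>r\<close>-th ancestor of \<open>v\<close> is a spine with \<open>r + 1\<close> off-spine trees and a position of the spine
  child at each of the \<open>r\<close> proper ancestors. Its probability is a product of Poisson weights, and summing
  over the positions turns the weight of \<open>k + 1\<close> children into that of \<open>k\<close> off-spine children. Hence the
  off-spine trees are i.i.d. \<open>PGW(1)\<close>. As these probabilities sum to one, parents exist almost
  surely.

  \<open>T'\<close> is the reflected construction in the strip \<open>1 \<le> y < 2\<close>, whereas \<open>T\<close> uses \<open>0 \<le> y < 1\<close>. Thus \<open>T\<close>
  and \<open>T'\<close> are independent and not deterministic, and neither is a factor of the other.\<close>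

subsection \<open>The parent relation\<close>

text \<open>Run depth-first search from \<open>w\<close>, reading offspring numbers leftwards: just
  before \<open>u\<close> is read, \<open>1 + rise \<xi> u w\<close> nodes are pending,
  \<open>u\<close> included. So \<open>u\<close> lies in the tree of \<open>w\<close> iff this
  number stays positive down to \<open>u\<close>, and the nearest such \<open>w\<close> is where the
  walk seen from \<open>u\<close> first becomes nonnegative. It may overshoot 0 there; the excess
  counts the siblings of \<open>u\<close> that are still unread. The obstacle is that the two models
  live on different vertex sets, intervals of integers and Ulam-Harris words, and that neighborhoods
  are compared only up to isomorphism. Both are therefore described by the same finite shapes (plane
  forests, and spines carrying forests), and a shape is shown to determine the neighborhood.
  Comparing local laws then means comparing two laws on a countable set of shapes, and no recurrence
  theorem for the mean-zero walk enters. Connectedness is deterministic once parents exist: parent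
  edges do not cross, so any two ancestral lines merge.\<close>

definition rise :: "(int \<Rightarrow> nat) \<Rightarrow> int \<Rightarrow> int \<Rightarrow> int" where
  "rise \<xi> u w = (\<Sum>i\<in>{u<..w}. int (\<xi> i) - 1)"

text \<open>Lukasiewicz coding: the parent of \<open>u\<close> is the first \<open>w > u\<close> at which the walk with steps
  \<open>\<xi> i - 1\<close> is no longer below its height at \<open>u\<close>.\<close>

definition par :: "(int \<Rightarrow> nat) \<Rightarrow> int \<Rightarrow> int \<Rightarrow> bool" where
  "par \<xi> u w \<longleftrightarrow> u < w \<and> 0 \<le> rise \<xi> u w \<and> (\<forall>x. u < x \<and> x < w \<longrightarrow> rise \<xi> u x < 0)"

lemma rise_self [simp]: "rise \<xi> u u = 0"
  by (simp add: rise_def)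

lemma rise_split: "u \<le> m \<Longrightarrow> m \<le> w \<Longrightarrow> rise \<xi> u w = rise \<xi> u m + rise \<xi> m w"
  unfolding rise_def by (subst sum.union_disjoint [symmetric]) (auto intro!: sum.cong)

lemma rise_last: "u < w \<Longrightarrow> rise \<xi> u w = rise \<xi> u (w - 1) + int (\<xi> w) - 1"
proof -
  assume "u < w"
  then have "rise \<xi> u w = rise \<xi> u (w - 1) + rise \<xi> (w - 1) w"
    by (intro rise_split) auto
  moreover have "{w - 1<..w} = {w}" by auto
  ultimately show ?thesis by (simp add: rise_def)
qed

lemma par_less: "par \<xi> u w \<Longrightarrow> u < w"
  by (simp add: par_def)

lemma par_unique: "par \<xi> u w \<Longrightarrow> par \<xi> u w' \<Longrightarrow> w = w'"
  unfolding par_def by (metis linorder_less_linear not_less)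

lemma par_no_rise: "par \<xi> u w \<Longrightarrow> (\<And>x. u < x \<Longrightarrow> x \<le> z \<Longrightarrow> rise \<xi> u x < 0) \<Longrightarrow> z < w"
  unfolding par_def by (meson linorder_not_le)

lemma par_exists_le:
  assumes "u < z" "0 \<le> rise \<xi> u z"
  obtains w where "par \<xi> u w" "w \<le> z"
proof -
  define n where "n = (LEAST n. 0 \<le> rise \<xi> u (u + 1 + int n))"
  have ex: "0 \<le> rise \<xi> u (u + 1 + int (nat (z - u - 1)))"
    using assms by simp
  have n: "0 \<le> rise \<xi> u (u + 1 + int n)"
    unfolding n_def by (rule LeastI) (rule ex)
  have le: "n \<le> nat (z - u - 1)"
    unfolding n_def by (rule Least_le) (rule ex)
  have "rise \<xi> u x < 0" if "u < x" "x < u + 1 + int n" for x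
  proof -
    have "nat (x - u - 1) < n" using that by linarith
    then have "\<not> 0 \<le> rise \<xi> u (u + 1 + int (nat (x - u - 1)))"
      unfolding n_def by (rule not_less_Least)
    with that show ?thesis by simp
  qed
  with n have "par \<xi> u (u + 1 + int n)" by (simp add: par_def)
  moreover have "u + 1 + int n \<le> z" using le assms by linarith
  ultimately show thesis by (rule that)
qed

subsection \<open>Finite plane forests\<close>

text \<open>In \<open>Tree f g\<close> the first tree of the forest has its branches in \<open>f\<close>, and \<open>g\<close> is the rest. A tree is
  represented by the forest of its branches.\<close>

datatype forest = Void | Tree forest forest

instance forest :: countable
  by countable_datatype

fun width :: "forest \<Rightarrow> nat" where
  "width Void = 0"
| "width (Tree f g) = Suc (width g)"

fun extent :: "forest \<Rightarrow> int" where
  "extent Void = 0"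
| "extent (Tree f g) = 1 + extent f + extent g"

text \<open>Reading \<open>\<xi>\<close> leftwards from \<open>x\<close> yields the offspring numbers of the forest in preorder.\<close>

fun matches_forest :: "(int \<Rightarrow> nat) \<Rightarrow> int \<Rightarrow> forest \<Rightarrow> bool" where
  "matches_forest \<xi> x Void \<longleftrightarrow> True"
| "matches_forest \<xi> x (Tree f g) \<longleftrightarrow>
     \<xi> x = width f \<and> matches_forest \<xi> (x - 1) f \<and> matches_forest \<xi> (x - 1 - extent f) g"

fun roots :: "int \<Rightarrow> forest \<Rightarrow> int set" where
  "roots x Void = {}"
| "roots x (Tree f g) = insert x (roots (x - 1 - extent f) g)"

abbreviation block :: "int \<Rightarrow> forest \<Rightarrow> int set" where
  "block x f \<equiv> {x - extent f<..x}"

lemma extent_nonneg: "0 \<le> extent f"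
  by (induction f) auto

lemma block_Tree: "block x (Tree f g) = insert x (block (x - 1) f \<union> block (x - 1 - extent f) g)"
  using extent_nonneg[of f] extent_nonneg[of g] by auto

lemma roots_subset: "roots x f \<subseteq> block x f"
proof (induction f arbitrary: x)
  case (Tree f g)
  then show ?case unfolding block_Tree by (simp add: le_supI2 subset_insertI2)
qed auto

text \<open>Once the number of trees is known, the preorder word is parsed deterministically. This
  prefix property later makes the events of different shapes disjoint.\<close>

lemma matches_forest_unique:
  "matches_forest \<xi> x f \<Longrightarrow> matches_forest \<xi> x g \<Longrightarrow> width f = width g \<Longrightarrow> f = g"
proof (induction f arbitrary: x g)
  case Void
  then show ?case by (cases g) auto
next
  case (Tree f1 f2)
  then obtain g1 g2 where g: "g = Tree g1 g2" by (cases g) auto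
  with Tree.prems have "f1 = g1" by (intro Tree.IH(1)[of "x - 1"]) auto
  moreover from this g Tree.prems have "f2 = g2"
    by (intro Tree.IH(2)[of "x - 1 - extent f1"]) auto
  ultimately show ?case using g by simp
qed

text \<open>A tree with \<open>n\<close> vertices has \<open>n - 1\<close> edges, so offspring
  numbers minus one add up to -1 over each tree of the forest.\<close>

lemma matches_forest_rise: "matches_forest \<xi> x f \<Longrightarrow> rise \<xi> (x - extent f) x = - int (width f)"
proof (induction f arbitrary: x)
  case (Tree f g)
  let ?m = "x - 1 - extent f" and ?e = "x - extent (Tree f g)"
  have "rise \<xi> ?e x = rise \<xi> ?e (x - 1) + int (\<xi> x) - 1"
    using extent_nonneg[of f] extent_nonneg[of g]
    by (intro rise_last) simp
  moreover have "rise \<xi> ?e (x - 1) = rise \<xi> ?e ?m + rise \<xi> ?m (x - 1)"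
    using extent_nonneg[of f] extent_nonneg[of g] by (intro rise_split) auto
  moreover have "rise \<xi> ?m (x - 1) = - int (width f)"
    using Tree.IH(1)[of "x - 1"] Tree.prems by (simp add: algebra_simps)
  moreover have "rise \<xi> ?e ?m = - int (width g)"
    using Tree.IH(2)[of ?m] Tree.prems by (simp add: algebra_simps)
  ultimately show ?case using Tree.prems by simp
qed simp

text \<open>The block positions up to \<open>y\<close> form a nonempty suffix of the preorder word.
  Such a suffix codes a forest with at least one tree, so its sum is negative.\<close>

lemma matches_forest_rise_neg:
  "matches_forest \<xi> x f \<Longrightarrow> y \<in> block x f \<Longrightarrow> rise \<xi> (x - extent f) y < 0"
proof (induction f arbitrary: x y)
  case (Tree f g)
  let ?m = "x - 1 - extent f" and ?e = "x - extent (Tree f g)"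
  have e: "?e = ?m - extent g" by simp
  have m: "rise \<xi> ?e ?m = - int (width g)"
    unfolding e using matches_forest_rise[of \<xi> ?m g] Tree.prems(1) by simp
  consider "y = x" | "y \<in> block (x - 1) f" | "y \<in> block ?m g"
    using Tree.prems(2) unfolding block_Tree by blast
  then show ?case
  proof cases
    case 1
    with matches_forest_rise[OF Tree.prems(1)] show ?thesis by simp
  next
    case 2
    have "rise \<xi> ?e y = rise \<xi> ?e ?m + rise \<xi> ?m y"
      using 2 extent_nonneg[of g] by (intro rise_split) auto
    with Tree.IH(1)[of "x - 1" y] 2 Tree.prems m show ?thesis by (simp add: algebra_simps)
  next
    case 3
    with Tree.IH(2)[of ?m y] Tree.prems show ?thesis unfolding e by simp
  qed
qed simp

text \<open>Between a root \<open>c\<close> and \<open>x\<close> lie only complete trees, at most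
  \<open>width f - 1\<close> of them, each contributing -1. The lower bound lets a vertex at
  \<open>x + 1\<close> with \<open>width f\<close> offspring lift the walk to 0 or above; the
  negativity excludes an earlier parent.\<close>

lemma roots_rise:
  "matches_forest \<xi> x f \<Longrightarrow> c \<in> roots x f \<Longrightarrow>
    1 - int (width f) \<le> rise \<xi> c x \<and> (\<forall>w. c < w \<longrightarrow> w \<le> x \<longrightarrow> rise \<xi> c w < 0)"
proof (induction f arbitrary: x)
  case (Tree f g)
  let ?m = "x - 1 - extent f"
  show ?case
  proof (cases "c = x")
    case True
    then show ?thesis by simp
  next
    case False
    with Tree.prems have c: "c \<in> roots ?m g" by simp
    with roots_subset[of ?m g] have cm: "c \<le> ?m" by auto
    have IH: "1 - int (width g) \<le> rise \<xi> c ?m" "\<And>w. c < w \<Longrightarrow> w \<le> ?m \<Longrightarrow> rise \<xi> c w < 0"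
      using Tree.IH(2)[of ?m] c Tree.prems(1) by auto
    have T: "matches_forest \<xi> x (Tree f Void)" using Tree.prems(1) by simp
    have mx: "rise \<xi> ?m x = -1" using matches_forest_rise[OF T] by (simp add: algebra_simps)
    have neg: "rise \<xi> ?m y < 0" if "?m < y" "y \<le> x" for y
      using matches_forest_rise_neg[OF T, of y] that by (simp add: algebra_simps)
    have cm0: "rise \<xi> c ?m \<le> 0"
      using IH(2)[of ?m] cm by (cases "c = ?m") auto
    have "1 - int (width (Tree f g)) \<le> rise \<xi> c x"
      using rise_split[of c ?m x \<xi>] extent_nonneg[of f] cm mx IH(1) by simp
    moreover have "rise \<xi> c w < 0" if "c < w" "w \<le> x" for w
    proof (cases "w \<le> ?m")
      case True
      with that IH(2) show ?thesis by blast
    next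
      case w: False
      then have "rise \<xi> c w = rise \<xi> c ?m + rise \<xi> ?m w"
        using cm by (intro rise_split) auto
      with neg[of w] w that cm0 show ?thesis by simp
    qed
    ultimately show ?thesis by blast
  qed
qed simp

lemma roots_par:
  assumes "matches_forest \<xi> (x - 1) f" "\<xi> x = width f" "c \<in> roots (x - 1) f"
  shows "par \<xi> c x"
proof -
  have "c < x" using roots_subset[of "x - 1" f] assms(3) by auto
  then show ?thesis
    using roots_rise[OF assms(1,3)] rise_last[of c x \<xi>] assms(2)
    by (simp add: par_def)
qed

lemma roots_par_beyond: "matches_forest \<xi> x f \<Longrightarrow> c \<in> roots x f \<Longrightarrow> par \<xi> c w \<Longrightarrow> x < w"
  using roots_rise par_no_rise by blast

lemma nonroot_par:
  "matches_forest \<xi> x f \<Longrightarrow> u \<in> block x f \<Longrightarrow> u \<notin> roots x f \<Longrightarrow> \<exists>w\<in>block x f. par \<xi> u w"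
proof (induction f arbitrary: x)
  case (Tree f g)
  let ?m = "x - 1 - extent f"
  consider "u \<in> block (x - 1) f" | "u \<in> block ?m g"
    using Tree.prems unfolding block_Tree by auto
  then show ?case
  proof cases
    case 1
    then show ?thesis
      using Tree.IH(1)[of "x - 1"] Tree.prems(1) roots_par[of \<xi> x f u]
      unfolding block_Tree by auto
  next
    case 2
    then show ?thesis
      using Tree.IH(2)[of ?m] Tree.prems unfolding block_Tree by auto
  qed
qed auto

text \<open>Seen from a vertex left of the block, the walk is at most 0 at the left end, and inside
  the block it stays below its value there. Hence blocks are closed under taking children.\<close>

lemma par_into_block:
  assumes "matches_forest \<xi> x f" "w \<in> block x f" "par \<xi> u w"
  shows "u \<in> block x f"
proof (rule ccontr)
  let ?e = "x - extent f"
  assume "u \<notin> block x f"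
  with assms have ue: "u \<le> ?e" using par_less[OF assms(3)] by auto
  then have "rise \<xi> u w = rise \<xi> u ?e + rise \<xi> ?e w"
    using assms(2) by (intro rise_split) auto
  moreover have "rise \<xi> ?e w < 0" using matches_forest_rise_neg assms by blast
  moreover have "rise \<xi> u ?e \<le> 0"
  proof (cases "u = ?e")
    case False
    with ue have "u < ?e" by simp
    moreover have "?e < w" using assms(2) by simp
    ultimately show ?thesis using assms(3) unfolding par_def by force
  qed simp
  ultimately show False using assms(3) unfolding par_def by linarith
qed

subsection \<open>Abstract forest and spine structures\<close>

text \<open>\<open>K\<close> and \<open>K'\<close> are the children of \<open>v\<close> in \<open>D\<close> and \<open>D'\<close>, with \<open>P x y\<close> meaning that \<open>y\<close> is the parent
  of \<open>x\<close>.\<close>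

definition glue :: "('v \<Rightarrow> 'v \<Rightarrow> bool) \<Rightarrow> 'v \<Rightarrow> 'v set \<Rightarrow> 'v set \<Rightarrow> 'v set \<Rightarrow> 'v set \<Rightarrow> bool" where
  "glue P v D K D' K' \<longleftrightarrow> v \<notin> D \<and> v \<notin> D' \<and> D \<inter> D' = {} \<and> \<not> P v v \<and>
     (\<forall>x\<in>D. (P x v \<longleftrightarrow> x \<in> K) \<and> \<not> P v x) \<and> (\<forall>x\<in>D'. (P x v \<longleftrightarrow> x \<in> K') \<and> \<not> P v x) \<and>
     (\<forall>x\<in>D. \<forall>y\<in>D'. \<not> P x y \<and> \<not> P y x)"

text \<open>The shape is certified for an arbitrary set with a relation, so that it applies to
  integers and to Ulam-Harris words alike, and also to sets of integers with gaps.\<close>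

fun is_forest :: "('v \<Rightarrow> 'v \<Rightarrow> bool) \<Rightarrow> 'v set \<Rightarrow> 'v set \<Rightarrow> forest \<Rightarrow> bool" where
  "is_forest P D R Void \<longleftrightarrow> D = {} \<and> R = {}"
| "is_forest P D R (Tree f g) \<longleftrightarrow> (\<exists>v D1 R1 D2 R2.
     is_forest P D1 R1 f \<and> is_forest P D2 R2 g \<and> glue P v D1 R1 D2 {} \<and>
     D = insert v (D1 \<union> D2) \<and> R = insert v R2)"

text \<open>The path from \<open>a\<close> up to \<open>t\<close>; the list of the forests hanging off it starts at the top \<open>t\<close>, while \<open>f0\<close>
  hangs off \<open>a\<close>.\<close>

fun is_spine ::
    "('v \<Rightarrow> 'v \<Rightarrow> bool) \<Rightarrow> 'v set \<Rightarrow> 'v \<Rightarrow> 'v \<Rightarrow> forest \<Rightarrow> forest list \<Rightarrow> bool" where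
  "is_spine P D a t f0 [] \<longleftrightarrow> (\<exists>D1 R1.
     is_forest P D1 R1 f0 \<and> glue P t D1 R1 {} {} \<and> D = insert t D1 \<and> t = a)"
| "is_spine P D a t f0 (f # fs) \<longleftrightarrow> (\<exists>D1 t1 D2 R2.
     is_spine P D1 a t1 f0 fs \<and> is_forest P D2 R2 f \<and> glue P t D1 {t1} D2 R2 \<and>
     D = insert t (D1 \<union> D2))"

definition iso_on ::
    "('v \<Rightarrow> 'v \<Rightarrow> bool) \<Rightarrow> 'v set \<Rightarrow> ('w \<Rightarrow> 'w \<Rightarrow> bool) \<Rightarrow> 'w set \<Rightarrow> ('v \<Rightarrow> 'w) \<Rightarrow> bool" where
  "iso_on P D P' D' \<phi> \<longleftrightarrow> bij_betw \<phi> D D' \<and> (\<forall>x\<in>D. \<forall>y\<in>D. P x y \<longleftrightarrow> P' (\<phi> x) (\<phi> y))"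

text \<open>\<open>glue\<close> leaves no freedom: all relations between \<open>v\<close>,
  \<open>D\<close> and \<open>E\<close> are determined by \<open>K\<close> and \<open>L\<close>.
  Isomorphisms of the pieces that match these sets therefore combine.\<close>

lemma iso_on_glue:
  assumes "glue P v D K E L" "glue P' v' D' K' E' L'"
    and "iso_on P D P' D' \<phi>" "\<phi> ` K = K'" "K \<subseteq> D"
    and "iso_on P E P' E' \<psi>" "\<psi> ` L = L'" "L \<subseteq> E"
  obtains \<theta> where "iso_on P (insert v (D \<union> E)) P' (insert v' (D' \<union> E')) \<theta>"
    and "\<theta> v = v'" "\<And>x. x \<in> D \<Longrightarrow> \<theta> x = \<phi> x" "\<And>x. x \<in> E \<Longrightarrow> \<theta> x = \<psi> x"
proof -
  define \<theta> where "\<theta> x = (if x = v then v' else if x \<in> D then \<phi> x else \<psi> x)" for x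
  have v: "\<theta> v = v'" by (simp add: \<theta>_def)
  have D: "\<theta> x = \<phi> x" "\<phi> x \<in> D'" "\<theta> x \<in> D'" if "x \<in> D" for x
    using that assms(1,3) by (auto simp: \<theta>_def glue_def iso_on_def bij_betw_def)
  have E: "\<theta> x = \<psi> x" "\<psi> x \<in> E'" "\<theta> x \<in> E'" if "x \<in> E" for x
    using that assms(1,6) by (auto simp: \<theta>_def glue_def iso_on_def bij_betw_def)
  have bD: "bij_betw \<theta> D D'"
    using assms(3) D by (metis bij_betw_cong iso_on_def)
  have bE: "bij_betw \<theta> E E'"
    using assms(6) E by (metis bij_betw_cong iso_on_def)
  have K: "\<theta> x \<in> K' \<longleftrightarrow> x \<in> K" if "x \<in> D" for x
  proof -
    have "\<theta> ` K = K'" using assms(4,5) D(1) by (metis image_cong subsetD)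
    then show ?thesis
      using that bD assms(5) inj_on_image_mem_iff[of \<theta> D x K] by (auto simp: bij_betw_def)
  qed
  have L: "\<theta> x \<in> L' \<longleftrightarrow> x \<in> L" if "x \<in> E" for x
  proof -
    have "\<theta> ` L = L'" using assms(7,8) E(1) by (metis image_cong subsetD)
    then show ?thesis
      using that bE assms(8) inj_on_image_mem_iff[of \<theta> E x L] by (auto simp: bij_betw_def)
  qed
  have dis: "v \<notin> D \<union> E" "v' \<notin> D' \<union> E'" "D \<inter> E = {}" "D' \<inter> E' = {}"
    using assms(1,2) by (auto simp: glue_def)
  have "bij_betw \<theta> (D \<union> E) (D' \<union> E')"
    using bD bE dis by (intro bij_betw_combine) auto
  then have "bij_betw \<theta> (insert v (D \<union> E)) (insert v' (D' \<union> E'))"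
    using notIn_Un_bij_betw[of v "D \<union> E" \<theta> "D' \<union> E'"] dis v by simp
  moreover have "P x y \<longleftrightarrow> P' (\<theta> x) (\<theta> y)"
    if "x \<in> insert v (D \<union> E)" "y \<in> insert v (D \<union> E)" for x y
  proof -
    have DD: "P x y \<longleftrightarrow> P' (\<phi> x) (\<phi> y)" if "x \<in> D" "y \<in> D"
      using that assms(3) by (simp add: iso_on_def)
    have EE: "P x y \<longleftrightarrow> P' (\<psi> x) (\<psi> y)" if "x \<in> E" "y \<in> E"
      using that assms(6) by (simp add: iso_on_def)
    have Dv: "P x v \<longleftrightarrow> P' (\<phi> x) v'" if "x \<in> D" for x
      using assms(1,2) D[OF that] K[OF that] that unfolding glue_def by metis
    have Ev: "P x v \<longleftrightarrow> P' (\<psi> x) v'" if "x \<in> E" for x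
      using assms(1,2) E[OF that] L[OF that] that unfolding glue_def by metis
    have no: "\<not> P v v" "\<not> P' v' v'"
      "\<And>x. x \<in> D \<Longrightarrow> \<not> P v x" "\<And>x. x \<in> E \<Longrightarrow> \<not> P v x"
      "\<And>x. x \<in> D' \<Longrightarrow> \<not> P' v' x" "\<And>x. x \<in> E' \<Longrightarrow> \<not> P' v' x"
      "\<And>x y. x \<in> D \<Longrightarrow> y \<in> E \<Longrightarrow> \<not> P x y \<and> \<not> P y x"
      "\<And>x y. x \<in> D' \<Longrightarrow> y \<in> E' \<Longrightarrow> \<not> P' x y \<and> \<not> P' y x"
      using assms(1,2) unfolding glue_def by blast+
    have "x = v \<or> x \<in> D \<or> x \<in> E" "y = v \<or> y \<in> D \<or> y \<in> E"
      using that by auto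
    then show ?thesis
      by (elim disjE) (simp_all add: v no D(1,2) E(1,2) Dv Ev DD EE)
  qed
  ultimately have "iso_on P (insert v (D \<union> E)) P' (insert v' (D' \<union> E')) \<theta>"
    by (simp add: iso_on_def)
  then show thesis using v D(1) E(1) by (rule that)
qed

lemma is_forest_roots: "is_forest P D R f \<Longrightarrow> R \<subseteq> D"
proof (induction f arbitrary: D R)
  case (Tree f g)
  then show ?case by (auto simp del: subsetI) blast
qed simp

text \<open>The root sets are carried along because the next \<open>glue\<close> attaches exactly
  these roots to a common parent.\<close>

lemma is_forest_iso:
  assumes "is_forest P D R f" "is_forest P' D' R' f"
  shows "\<exists>\<phi>. iso_on P D P' D' \<phi> \<and> \<phi> ` R = R'"
  using assms
proof (induction f arbitrary: D R D' R')
  case Void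
  then show ?case by (simp add: iso_on_def bij_betw_def)
next
  case (Tree f g)
  obtain v D1 R1 D2 R2 where 1: "is_forest P D1 R1 f" "is_forest P D2 R2 g"
    "glue P v D1 R1 D2 {}" "D = insert v (D1 \<union> D2)" "R = insert v R2"
    using Tree.prems(1) by auto
  obtain v' D1' R1' D2' R2' where 2: "is_forest P' D1' R1' f" "is_forest P' D2' R2' g"
    "glue P' v' D1' R1' D2' {}" "D' = insert v' (D1' \<union> D2')" "R' = insert v' R2'"
    using Tree.prems(2) by auto
  obtain \<phi> where \<phi>: "iso_on P D1 P' D1' \<phi>" "\<phi> ` R1 = R1'"
    using Tree.IH(1)[OF 1(1) 2(1)] by auto
  obtain \<psi> where \<psi>: "iso_on P D2 P' D2' \<psi>" "\<psi> ` R2 = R2'"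
    using Tree.IH(2)[OF 1(2) 2(2)] by auto
  obtain \<theta> where \<theta>: "iso_on P (insert v (D1 \<union> D2)) P' (insert v' (D1' \<union> D2')) \<theta>"
    "\<theta> v = v'" "\<And>x. x \<in> D2 \<Longrightarrow> \<theta> x = \<psi> x"
    using iso_on_glue[OF 1(3) 2(3) \<phi> is_forest_roots[OF 1(1)] \<psi>(1)] by auto
  have "\<theta> ` R2 = R2'"
    using \<psi>(2) \<theta>(3) is_forest_roots[OF 1(2)] by (metis image_cong subsetD)
  with \<theta> 1 2 show ?case by auto
qed

lemma is_spine_top: "is_spine P D a t f0 fs \<Longrightarrow> t \<in> D \<and> a \<in> D"
proof (induction fs arbitrary: D t)
  case (Cons f fs)
  then show ?case by (auto simp: is_spine.simps) 
qed auto

lemma is_spine_iso: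
  assumes "is_spine P D a t f0 fs" "is_spine P' D' a' t' f0 fs"
  shows "\<exists>\<phi>. iso_on P D P' D' \<phi> \<and> \<phi> a = a' \<and> \<phi> t = t'"
  using assms
proof (induction fs arbitrary: D t D' t')
  case Nil
  obtain D1 R1 where 1: "is_forest P D1 R1 f0" "glue P t D1 R1 {} {}" "D = insert t D1" "t = a"
    using Nil.prems(1) by auto
  obtain D1' R1' where 2: "is_forest P' D1' R1' f0" "glue P' t' D1' R1' {} {}"
    "D' = insert t' D1'" "t' = a'"
    using Nil.prems(2) by auto
  obtain \<phi> where \<phi>: "iso_on P D1 P' D1' \<phi>" "\<phi> ` R1 = R1'"
    using is_forest_iso[OF 1(1) 2(1)] by auto
  have e: "iso_on P {} P' {} \<phi>" by (simp add: iso_on_def bij_betw_def)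
  obtain \<theta> where "iso_on P (insert t (D1 \<union> {})) P' (insert t' (D1' \<union> {})) \<theta>" "\<theta> t = t'"
    using iso_on_glue[OF 1(2) 2(2) \<phi> is_forest_roots[OF 1(1)] e] by auto
  with 1 2 show ?case by auto
next
  case (Cons f fs)
  obtain D1 t1 D2 R2 where 1: "is_spine P D1 a t1 f0 fs" "is_forest P D2 R2 f"
    "glue P t D1 {t1} D2 R2" "D = insert t (D1 \<union> D2)"
    using Cons.prems(1) by auto
  obtain D1' t1' D2' R2' where 2: "is_spine P' D1' a' t1' f0 fs" "is_forest P' D2' R2' f"
    "glue P' t' D1' {t1'} D2' R2'" "D' = insert t' (D1' \<union> D2')"
    using Cons.prems(2) by auto
  obtain \<phi> where \<phi>: "iso_on P D1 P' D1' \<phi>" "\<phi> a = a'" "\<phi> t1 = t1'"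
    using Cons.IH[OF 1(1) 2(1)] by auto
  obtain \<psi> where \<psi>: "iso_on P D2 P' D2' \<psi>" "\<psi> ` R2 = R2'"
    using is_forest_iso[OF 1(2) 2(2)] by auto
  have "\<phi> ` {t1} = {t1'}" "{t1} \<subseteq> D1" using \<phi> is_spine_top[OF 1(1)] by auto
  then obtain \<theta> where \<theta>: "iso_on P (insert t (D1 \<union> D2)) P' (insert t' (D1' \<union> D2')) \<theta>"
    "\<theta> t = t'" "\<And>x. x \<in> D1 \<Longrightarrow> \<theta> x = \<phi> x"
    using iso_on_glue[OF 1(3) 2(3) \<phi>(1) _ _ \<psi> is_forest_roots[OF 1(2)]] by metis
  with \<phi>(2) is_spine_top[OF 1(1)] have "\<theta> a = a'" by auto
  with \<theta> 1 2 show ?case by auto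
qed

subsection \<open>Forests and spines in the parent relation\<close>

text \<open>The point is that no parent edge joins the two blocks: a vertex of the block of
  \<open>g\<close> has its parent inside that block or, being also a root of the whole forest,
  beyond \<open>x\<close>.\<close>

lemma glue_block:
  assumes "matches_forest \<xi> x (Tree f g)"
  shows "glue (par \<xi>) x (block (x - 1) f) (roots (x - 1) f) (block (x - 1 - extent f) g) {}"
proof -
  let ?m = "x - 1 - extent f"
  have f: "\<xi> x = width f" "matches_forest \<xi> (x - 1) f" and g: "matches_forest \<xi> ?m g"
    using assms by auto
  have 1: "par \<xi> u x \<longleftrightarrow> u \<in> roots (x - 1) f" if "u \<in> block (x - 1) f" for u
  proof
    assume "par \<xi> u x"
    with nonroot_par[OF f(2) that] show "u \<in> roots (x - 1) f"
      using par_unique by fastforce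
  qed (use roots_par f in blast)
  have 2: "w \<le> ?m \<or> w > x" if "u \<in> block ?m g" "par \<xi> u w" for u w
  proof (cases "u \<in> roots ?m g")
    case True
    then have "u \<in> roots x (Tree f g)" by simp
    with roots_par_beyond assms that show ?thesis by blast
  next
    case False
    with nonroot_par[OF g that(1)] that(2) par_unique show ?thesis by fastforce
  qed
  have 3: "\<not> par \<xi> u w" if "w \<le> u" for w u
    using that by (auto simp: par_def)
  have "\<not> par \<xi> u w \<and> \<not> par \<xi> w u" if "u \<in> block (x - 1) f" "w \<in> block ?m g" for u w
    using 2[of w u] 3[of w u] that by auto
  moreover have "\<not> par \<xi> u x" if "u \<in> block ?m g" for u
    using 2[of u x] that extent_nonneg[of f] by force
  moreover have "\<not> par \<xi> x u" if "u \<in> block ?m g \<union> block (x - 1) f" for u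
    using that extent_nonneg[of f] by (intro 3) auto
  moreover have "\<not> par \<xi> x x" by (rule 3) simp
  ultimately show ?thesis
    unfolding glue_def using 1 extent_nonneg[of f] by auto
qed

lemma matches_forest_is_forest: "matches_forest \<xi> x f \<Longrightarrow> is_forest (par \<xi>) (block x f) (roots x f) f"
proof (induction f arbitrary: x)
  case (Tree f g)
  have "is_forest (par \<xi>) (block (x - 1) f) (roots (x - 1) f) f"
    "is_forest (par \<xi>) (block (x - 1 - extent f) g) (roots (x - 1 - extent f) g) g"
    using Tree by auto
  with glue_block[OF Tree.prems] show ?case
    unfolding is_forest.simps block_Tree roots.simps by blast
qed simp

section \<open>Grafting a branch at a marked position, and spines built by repeated grafting\<close>

text \<open>Only meaningful for \<open>j \<le> width f\<close>.\<close>

fun insert_tree :: "nat \<Rightarrow> forest \<Rightarrow> forest \<Rightarrow> forest" where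
  "insert_tree 0 f y = Tree y f"
| "insert_tree (Suc j) Void y = Void"
| "insert_tree (Suc j) (Tree f g) y = Tree f (insert_tree j g y)"

text \<open>This is the space taken by the \<open>j\<close> trees in front of the insertion point.
  The inserted tree does not enter, so its root can be located without knowing it.\<close>

fun offset :: "nat \<Rightarrow> forest \<Rightarrow> int" where
  "offset 0 f = 0"
| "offset (Suc j) Void = 0"
| "offset (Suc j) (Tree f g) = 1 + extent f + offset j g"

definition matches_tree :: "(int \<Rightarrow> nat) \<Rightarrow> int \<Rightarrow> forest \<Rightarrow> bool" where
  "matches_tree \<xi> v f \<longleftrightarrow> matches_forest \<xi> v (Tree f Void)"

abbreviation tree_block :: "int \<Rightarrow> forest \<Rightarrow> int set" where
  "tree_block v f \<equiv> block v (Tree f Void)"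

lemma offset_nonneg: "0 \<le> offset j f"
proof (induction j f rule: offset.induct)
  case (3 j f g)
  then show ?case using extent_nonneg[of f] by simp
qed auto

lemma width_insert_tree: "j \<le> width f \<Longrightarrow> width (insert_tree j f y) = Suc (width f)"
  by (induction j f y rule: insert_tree.induct) auto

text \<open>The grafted forest alone does not reveal which branch was inserted. The offset does:
  every tree has positive extent, so different positions have different offsets.\<close>

lemma insert_tree_inject:
  "insert_tree j f y = insert_tree j' f' y' \<Longrightarrow> offset j f = offset j' f' \<Longrightarrow> j \<le> width f \<Longrightarrow> j' \<le> width f' \<Longrightarrow>
    j = j' \<and> f = f' \<and> y = y'"
proof (induction j f y arbitrary: j' f' rule: insert_tree.induct)
  case (1 f y)
  show ?case
  proof (cases j')
    case (Suc k)
    with 1 obtain a b where "f' = Tree a b" by (cases f') auto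
    with 1 Suc offset_nonneg[of k b] extent_nonneg[of a] show ?thesis by simp
  qed (use 1 in auto)
next
  case (3 j f g y)
  then obtain k where k: "j' = Suc k"
    using offset_nonneg[of j g] extent_nonneg[of f]
    by (cases j') auto
  with 3 obtain a b where "f' = Tree a b" by (cases f') auto
  with 3 k show ?case by auto
qed auto

text \<open>Removing the inserted tree leaves a set that need not be an interval, yet it still has
  the shape \<open>f\<close> for the parent relation. This is where the generality of
  \<open>is_forest\<close> pays off.\<close>

lemma matches_forest_insert_tree:
  assumes "matches_forest \<xi> x (insert_tree j f y)" "j \<le> width f"
  defines "t \<equiv> x - offset j f"
  shows "matches_tree \<xi> t y" "t \<in> roots x (insert_tree j f y)" "tree_block t y \<subseteq> block x (insert_tree j f y)"
    and "is_forest (par \<xi>) (block x (insert_tree j f y) - tree_block t y) (roots x (insert_tree j f y) - {t}) f"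
proof -
  have t: "t = x - offset j f" by (simp add: t_def)
  have "matches_tree \<xi> t y \<and> t \<in> roots x (insert_tree j f y) \<and> tree_block t y \<subseteq> block x (insert_tree j f y) \<and>
    is_forest (par \<xi>) (block x (insert_tree j f y) - tree_block t y) (roots x (insert_tree j f y) - {t}) f"
    using assms(1,2) t
  proof (induction j f y arbitrary: x t rule: insert_tree.induct)
    case (1 f y)
    let ?m = "x - 1 - extent y"
    have m: "matches_forest \<xi> x (Tree y f)" and t: "t = x" using 1 by auto
    have "is_forest (par \<xi>) (block ?m f) (roots ?m f) f"
      using m by (intro matches_forest_is_forest) auto
    moreover have "block x (Tree y f) - tree_block x y = block ?m f"
      using extent_nonneg[of y] extent_nonneg[of f] by auto
    moreover have "x \<notin> roots ?m f"
      using roots_subset[of ?m f] extent_nonneg[of y] by force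
    moreover have "tree_block x y \<subseteq> block x (Tree y f)"
      using extent_nonneg[of f] by auto
    ultimately show ?case using m unfolding t by (simp add: matches_tree_def)
  next
    case (2 j y)
    then show ?case by simp
  next
    case (3 j f g y)
    let ?m = "x - 1 - extent f" and ?i = "insert_tree j g y"
    have m: "matches_forest \<xi> x (Tree f ?i)" and t: "t = ?m - offset j g" using 3 by auto
    have IH: "matches_tree \<xi> t y" "t \<in> roots ?m ?i" "tree_block t y \<subseteq> block ?m ?i"
      "is_forest (par \<xi>) (block ?m ?i - tree_block t y) (roots ?m ?i - {t}) g"
      using 3(1)[of ?m] 3(2,3) unfolding t by auto
    have f: "is_forest (par \<xi>) (block (x - 1) f) (roots (x - 1) f) f"
      using m by (intro matches_forest_is_forest) auto
    have gl: "glue (par \<xi>) x (block (x - 1) f) (roots (x - 1) f) (block ?m ?i) {}"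
      by (rule glue_block[OF m])
    \<comment> \<open>The conditions in \<open>glue\<close> are elementwise, so they survive
      shrinking the second set.\<close>
    then have gl': "glue (par \<xi>) x (block (x - 1) f) (roots (x - 1) f) (block ?m ?i - tree_block t y) {}"
      unfolding glue_def by blast
    have "x \<notin> block ?m ?i" "block (x - 1) f \<inter> block ?m ?i = {}"
      using gl unfolding glue_def by blast+
    then have "block x (Tree f ?i) - tree_block t y = insert x (block (x - 1) f \<union> (block ?m ?i - tree_block t y))"
      using IH(3) unfolding block_Tree[of x f] by blast
    moreover have "roots x (Tree f ?i) - {t} = insert x (roots ?m ?i - {t})"
      using \<open>x \<notin> block ?m ?i\<close> IH(2) roots_subset[of ?m ?i] by (subst roots.simps) blast
    ultimately have "is_forest (par \<xi>) (block x (Tree f ?i) - tree_block t y)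
        (roots x (Tree f ?i) - {t}) (Tree f g)"
      using f IH(4) gl' unfolding is_forest.simps by blast
    moreover have "tree_block t y \<subseteq> block x (Tree f ?i)"
      using IH(3) unfolding block_Tree[of x f] by blast
    ultimately show ?case using IH by simp
  qed
  then show "matches_tree \<xi> t y" "t \<in> roots x (insert_tree j f y)" "tree_block t y \<subseteq> block x (insert_tree j f y)"
    and "is_forest (par \<xi>) (block x (insert_tree j f y) - tree_block t y) (roots x (insert_tree j f y) - {t}) f"
    by blast+
qed

text \<open>An entry \<open>(f, j)\<close> is an ancestor whose off-spine branches are \<open>f\<close> and whose branch number \<open>j\<close> leads
  back to the start \<open>v\<close>.\<close>

fun spine_forest :: "forest \<Rightarrow> (forest \<times> nat) list \<Rightarrow> forest" where
  "spine_forest f0 [] = f0"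
| "spine_forest f0 ((f, j) # xs) = insert_tree j f (spine_forest f0 xs)"

text \<open>In leftward preorder the \<open>j\<close> branches in front of the spine child lie
  between it and its parent, and the remaining branches lie to the left of its tree. So only the
  former push the ancestor to the right.\<close>

fun spine_pos :: "int \<Rightarrow> (forest \<times> nat) list \<Rightarrow> int" where
  "spine_pos v [] = v"
| "spine_pos v ((f, j) # xs) = spine_pos v xs + 1 + offset j f"

definition spine_match :: "(int \<Rightarrow> nat) \<Rightarrow> int \<Rightarrow> forest \<Rightarrow> (forest \<times> nat) list \<Rightarrow> bool" where
  "spine_match \<xi> v f0 xs \<longleftrightarrow>
     (\<forall>(f, j)\<in>set xs. j \<le> width f) \<and> matches_tree \<xi> (spine_pos v xs) (spine_forest f0 xs)"

lemma spine_match_step: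
  assumes "spine_match \<xi> v f0 ((f, j) # xs)"
  defines "n' \<equiv> spine_pos v xs" and "n \<equiv> spine_pos v ((f, j) # xs)" and "y \<equiv> spine_forest f0 xs"
  shows "spine_match \<xi> v f0 xs" "par \<xi> n' n"
    and "n' \<in> roots (n - 1) (insert_tree j f y)" "tree_block n' y \<subseteq> block (n - 1) (insert_tree j f y)"
    and "is_forest (par \<xi>) (block (n - 1) (insert_tree j f y) - tree_block n' y)
      (roots (n - 1) (insert_tree j f y) - {n'}) f"
proof -
  have m: "matches_forest \<xi> (n - 1) (insert_tree j f y)" "\<xi> n = width (insert_tree j f y)" and j: "j \<le> width f"
    and xs: "\<forall>(f, j)\<in>set xs. j \<le> width f"
    using assms by (auto simp: spine_match_def matches_tree_def)
  have t: "n - 1 - offset j f = n'" by (simp add: n_def n'_def)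
  note ins = matches_forest_insert_tree[OF m(1) j, unfolded t]
  show "spine_match \<xi> v f0 xs" using ins(1) xs by (simp add: spine_match_def n'_def y_def)
  show "par \<xi> n' n" using roots_par[OF m ins(2)] .
  show "n' \<in> roots (n - 1) (insert_tree j f y)" "tree_block n' y \<subseteq> block (n - 1) (insert_tree j f y)"
    and "is_forest (par \<xi>) (block (n - 1) (insert_tree j f y) - tree_block n' y)
      (roots (n - 1) (insert_tree j f y) - {n'}) f"
    by fact+
qed

text \<open>By induction the shorter spines agree. Their common top has only one parent, so the next
  tops are at the same position, where the tree is unique; equal positions also give equal offsets,
  and \<open>insert_tree_inject\<close> recovers the mark.\<close>

lemma spine_match_unique:
  "spine_match \<xi> v f0 xs \<Longrightarrow> spine_match \<xi> v f0' xs' \<Longrightarrow> length xs = length xs' \<Longrightarrow>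
    f0 = f0' \<and> xs = xs'"
proof (induction xs arbitrary: xs')
  case Nil
  then show ?case
    using matches_forest_unique[of \<xi> v "Tree f0 Void" "Tree f0' Void"]
    by (simp add: spine_match_def matches_tree_def)
next
  case (Cons x xs)
  obtain f j where x: "x = (f, j)" by (cases x)
  obtain f' j' ys where xs': "xs' = (f', j') # ys" using Cons.prems(3) by (cases xs') auto
  have 1: "spine_match \<xi> v f0 ((f, j) # xs)" and 2: "spine_match \<xi> v f0' ((f', j') # ys)"
    using Cons.prems x xs' by auto
  have eq: "f0 = f0'" "xs = ys"
    using Cons.IH[OF spine_match_step(1)[OF 1] spine_match_step(1)[OF 2]] Cons.prems(3) xs' by auto
  have pos: "spine_pos v ((f, j) # xs) = spine_pos v ((f', j') # ys)"
    using spine_match_step(2)[OF 1] spine_match_step(2)[OF 2] eq(2) par_unique by blast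
  then have off: "offset j f = offset j' f'" using eq by simp
  have "Tree (spine_forest f0 ((f, j) # xs)) Void = Tree (spine_forest f0' ((f', j') # ys)) Void"
    using 1 2 pos
    by (intro matches_forest_unique[of \<xi> "spine_pos v ((f, j) # xs)"])
      (simp_all add: spine_match_def matches_tree_def del: spine_pos.simps matches_forest.simps)
  then have "insert_tree j f (spine_forest f0 xs) = insert_tree j' f' (spine_forest f0' ys)" by simp
  then have "j = j' \<and> f = f'"
    using insert_tree_inject[OF _ off] 1 2 by (simp add: spine_match_def)
  with eq x xs' show ?case by simp
qed

lemma spine_match_par_into:
  "spine_match \<xi> v f0 xs \<Longrightarrow> w \<in> tree_block (spine_pos v xs) (spine_forest f0 xs) \<Longrightarrow> par \<xi> u w \<Longrightarrow>
    u \<in> tree_block (spine_pos v xs) (spine_forest f0 xs)"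
  using par_into_block[of \<xi> "spine_pos v xs"] unfolding spine_match_def matches_tree_def by blast

text \<open>Together with \<open>spine_match_par_into\<close>: the tree below the current ancestor
  touches the rest of the line only through the parent edge of its top.\<close>

lemma spine_match_par_from:
  assumes "spine_match \<xi> v f0 xs" "u \<in> tree_block (spine_pos v xs) (spine_forest f0 xs)"
    and "u \<noteq> spine_pos v xs" "par \<xi> u w"
  shows "w \<in> tree_block (spine_pos v xs) (spine_forest f0 xs)"
  using nonroot_par[of \<xi> "spine_pos v xs" "Tree (spine_forest f0 xs) Void" u] assms par_unique
  unfolding spine_match_def matches_tree_def by fastforce

lemma spine_match_is_spine:
  "spine_match \<xi> v f0 xs \<Longrightarrow>
    is_spine (par \<xi>) (tree_block (spine_pos v xs) (spine_forest f0 xs)) v (spine_pos v xs) f0 (map fst xs)"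
proof (induction xs)
  case Nil
  then have m: "matches_forest \<xi> v (Tree f0 Void)" by (simp add: spine_match_def matches_tree_def)
  have "is_forest (par \<xi>) (block (v - 1) f0) (roots (v - 1) f0) f0"
    using m by (intro matches_forest_is_forest) auto
  moreover have "glue (par \<xi>) v (block (v - 1) f0) (roots (v - 1) f0) {} {}"
    using glue_block[OF m] by simp
  moreover have "tree_block v f0 = insert v (block (v - 1) f0)"
    by (subst block_Tree) auto
  ultimately show ?case by (simp only: is_spine.simps spine_pos.simps spine_forest.simps list.map) blast
next
  case (Cons x xs)
  obtain f j where x: "x = (f, j)" by (cases x)
  define y where "y = spine_forest f0 xs"
  define n' where "n' = spine_pos v xs"
  define n where "n = spine_pos v ((f, j) # xs)"
  define D where "D = block (n - 1) (insert_tree j f y)"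
  define R where "R = roots (n - 1) (insert_tree j f y)"
  have sm: "spine_match \<xi> v f0 ((f, j) # xs)" using Cons.prems x by simp
  note st = spine_match_step[OF sm, folded y_def n'_def n_def, folded D_def R_def]
  have sp: "is_spine (par \<xi>) (tree_block n' y) v n' f0 (map fst xs)"
    using Cons.IH[OF st(1)] by (simp add: n'_def y_def)
  have "matches_forest \<xi> n (Tree (insert_tree j f y) Void)"
    using sm by (simp add: spine_match_def matches_tree_def n_def y_def)
  from glue_block[OF this] have gl: "glue (par \<xi>) n D R {} {}" by (simp add: D_def R_def)
  \<comment> \<open>Only the top \<open>n'\<close> can have its parent outside its own tree, and
    this parent is \<open>n\<close>, which is not in \<open>D\<close>.\<close>
  have 1: "\<not> par \<xi> p q" if "p \<in> tree_block n' y" "q \<in> D - tree_block n' y" for p q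
  proof
    assume "par \<xi> p q"
    then have "p = n'" using spine_match_par_from[OF st(1)] that unfolding n'_def y_def by blast
    with \<open>par \<xi> p q\<close> st(2) have "q = n" using par_unique by blast
    with gl that show False by (simp add: glue_def)
  qed
  have 2: "\<not> par \<xi> q p" if "p \<in> tree_block n' y" "q \<in> D - tree_block n' y" for p q
    using spine_match_par_into[OF st(1)] that unfolding n'_def y_def by blast
  have 3: "p = n'" if "p \<in> tree_block n' y" "par \<xi> p n" for p
  proof (rule ccontr)
    assume "p \<noteq> n'"
    then have "n \<in> tree_block n' y"
      using spine_match_par_from[OF st(1)] that unfolding n'_def y_def by blast
    with st(4) gl show False by (auto simp: glue_def)
  qed
  have n: "n \<notin> D" "\<not> par \<xi> n n" "\<And>x. x \<in> D \<Longrightarrow> par \<xi> x n \<longleftrightarrow> x \<in> R" "\<And>x. x \<in> D \<Longrightarrow> \<not> par \<xi> n x"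
    using gl unfolding glue_def by blast+
  have "n' \<in> tree_block n' y" using is_spine_top[OF sp] by blast
  have "glue (par \<xi>) n (tree_block n' y) {n'} (D - tree_block n' y) (R - {n'})"
    unfolding glue_def
  proof (intro conjI ballI)
    show "par \<xi> x n \<longleftrightarrow> x \<in> {n'}" if "x \<in> tree_block n' y" for x
      using 3[OF that] st(2) by blast
    show "par \<xi> x n \<longleftrightarrow> x \<in> R - {n'}" if "x \<in> D - tree_block n' y" for x
      using that n(3)[of x] \<open>n' \<in> tree_block n' y\<close> by blast
  qed (use n st(4) 1 2 in blast)+
  moreover have "tree_block n (insert_tree j f y) = insert n (tree_block n' y \<union> (D - tree_block n' y))"
  proof -
    have "tree_block n (insert_tree j f y) = insert n D"
      unfolding D_def by (subst block_Tree) auto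
    with st(4) show ?thesis by blast
  qed
  ultimately have "is_spine (par \<xi>) (tree_block n (insert_tree j f y)) v n f0 (f # map fst xs)"
    using sp st(5) unfolding is_spine.simps by blast
  then show ?case unfolding x by (simp add: n_def y_def)
qed

subsection \<open>Weights of forests\<close>

abbreviation pois :: "nat \<Rightarrow> real" where
  "pois \<equiv> pmf (poisson_pmf 1)"

fun forest_weight :: "forest \<Rightarrow> real" where
  "forest_weight Void = 1"
| "forest_weight (Tree f g) = pois (width f) * forest_weight f * forest_weight g"

definition tree_weight :: "forest \<Rightarrow> real" where
  "tree_weight f = pois (width f) * forest_weight f"

lemma forest_weight_Tree: "forest_weight (Tree f g) = tree_weight f * forest_weight g"
  by (simp add: tree_weight_def)

lemma forest_weight_pos: "0 < forest_weight f"
  by (induction f) auto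

lemma tree_weight_pos: "0 < tree_weight f"
  using forest_weight_pos by (simp add: tree_weight_def)

text \<open>Independent Poisson(1) variables, expressed by cylinder probabilities only: matching a
  finite shape fixes finitely many labels, so nothing more is asked of the box counts or of the
  product measure.\<close>

definition pois_family :: "'a measure \<Rightarrow> ('i \<Rightarrow> 'a \<Rightarrow> nat) \<Rightarrow> bool" where
  "pois_family M X \<longleftrightarrow> (\<forall>J a. finite J \<longrightarrow>
     {\<omega> \<in> space M. \<forall>y\<in>J. X y \<omega> = a y} \<in> sets M \<and>
     measure M {\<omega> \<in> space M. \<forall>y\<in>J. X y \<omega> = a y} = (\<Prod>y\<in>J. pois (a y)))"

lemma pois_family_labels:
  assumes "pois_family M X" "distinct (map fst L)"
  shows "{\<omega> \<in> space M. \<forall>(y, k)\<in>set L. X y \<omega> = k} \<in> sets M" (is "?A \<in> _")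
    and "measure M {\<omega> \<in> space M. \<forall>(y, k)\<in>set L. X y \<omega> = k} = prod_list (map (pois \<circ> snd) L)"
proof -
  define a where "a y = the (map_of L y)" for y
  have a: "a y = k" if "(y, k) \<in> set L" for y k
    using map_of_is_SomeI[OF assms(2) that] by (simp add: a_def)
  have eq: "?A = {\<omega> \<in> space M. \<forall>y\<in>set (map fst L). X y \<omega> = a y}"
    using a by (force simp: case_prod_beta)
  show "?A \<in> sets M"
    unfolding eq using assms(1) unfolding pois_family_def by blast
  have "measure M ?A = (\<Prod>y\<in>set (map fst L). pois (a y))"
    unfolding eq using assms(1) unfolding pois_family_def by blast
  also have "\<dots> = prod_list (map (\<lambda>y. pois (a y)) (map fst L))"
    by (rule prod.distinct_set_conv_list[OF assms(2)])
  also have "map (\<lambda>y. pois (a y)) (map fst L) = map (pois \<circ> snd) L"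
    using a by auto
  finally show "measure M ?A = prod_list (map (pois \<circ> snd) L)" .
qed

text \<open>Only labels strictly below \<open>u\<close> are read. That \<open>u\<close> itself has
  the right number of branches is checked one level up, or in \<open>tree_coded\<close> for the
  root.\<close>

fun coded :: "(nat list \<Rightarrow> nat) \<Rightarrow> nat list \<Rightarrow> nat \<Rightarrow> forest \<Rightarrow> bool" where
  "coded c u k Void \<longleftrightarrow> True"
| "coded c u k (Tree f g) \<longleftrightarrow>
     c (u @ [k]) = width f \<and> coded c (u @ [k]) 0 f \<and> coded c u (Suc k) g"

definition tree_coded :: "(nat list \<Rightarrow> nat) \<Rightarrow> forest \<Rightarrow> bool" where
  "tree_coded c f \<longleftrightarrow> c [] = width f \<and> coded c [] 0 f"

fun code_labels :: "nat list \<Rightarrow> nat \<Rightarrow> forest \<Rightarrow> (nat list \<times> nat) list" where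
  "code_labels u k Void = []"
| "code_labels u k (Tree f g) =
     (u @ [k], width f) # code_labels (u @ [k]) 0 f @ code_labels u (Suc k) g"

lemma coded_iff_labels: "coded c u k f \<longleftrightarrow> (\<forall>(y, n)\<in>set (code_labels u k f). c y = n)"
  by (induction f arbitrary: u k) (simp_all add: ball_Un)

lemma code_labels_below:
  "(y, n) \<in> set (code_labels u k f) \<Longrightarrow> \<exists>j w. y = u @ j # w \<and> k \<le> j"
proof (induction f arbitrary: u k)
  case (Tree f g)
  from Tree.prems consider "y = u @ [k]" | "(y, n) \<in> set (code_labels (u @ [k]) 0 f)"
    | "(y, n) \<in> set (code_labels u (Suc k) g)" by auto
  then show ?case
  proof cases
    case 2
    with Tree.IH(1)[of "u @ [k]" 0] show ?thesis by auto
  next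
    case 3
    with Tree.IH(2)[of u "Suc k"] show ?thesis using Suc_leD by blast
  qed auto
qed simp

lemma code_labels_distinct: "distinct (map fst (code_labels u k f))"
proof (induction f arbitrary: u k)
  case (Tree f g)
  show ?case
    using Tree.IH code_labels_below[of _ _ "u @ [k]" 0 f] code_labels_below[of _ _ u "Suc k" g]
    by (fastforce simp: disjoint_iff)
qed simp

lemma code_labels_weight: "prod_list (map (pois \<circ> snd) (code_labels u k f)) = forest_weight f"
  by (induction f arbitrary: u k) auto

lemma coded_unique:
  "coded c u k f \<Longrightarrow> coded c u k g \<Longrightarrow> width f = width g \<Longrightarrow> f = g"
proof (induction f arbitrary: u k g)
  case Void
  then show ?case by (cases g) auto
next
  case (Tree f1 f2)
  then obtain g1 g2 where g: "g = Tree g1 g2" by (cases g) auto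
  with Tree show ?case by force
qed

lemma tree_coded_unique: "tree_coded c f \<Longrightarrow> tree_coded c g \<Longrightarrow> f = g"
  using coded_unique unfolding tree_coded_def by metis

lemma tree_coded_prob:
  fixes X :: "nat list \<Rightarrow> 'a \<Rightarrow> nat"
  assumes "pois_family M X"
  shows "{\<omega> \<in> space M. tree_coded (\<lambda>u. X u \<omega>) f} \<in> sets M"
    and "measure M {\<omega> \<in> space M. tree_coded (\<lambda>u. X u \<omega>) f} = tree_weight f"
proof -
  let ?L = "([], width f) # code_labels [] 0 f"
  have eq: "{\<omega> \<in> space M. tree_coded (\<lambda>u. X u \<omega>) f} =
      {\<omega> \<in> space M. \<forall>(y, k)\<in>set ?L. X y \<omega> = k}"
    by (auto simp: tree_coded_def coded_iff_labels)
  have "distinct (map fst ?L)"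
    using code_labels_distinct[of "[]" 0 f] code_labels_below[of "[]" _ "[]" 0 f] by auto
  note L = pois_family_labels[OF assms this, folded eq]
  show "{\<omega> \<in> space M. tree_coded (\<lambda>u. X u \<omega>) f} \<in> sets M" by (rule L(1))
  show "measure M {\<omega> \<in> space M. tree_coded (\<lambda>u. X u \<omega>) f} = tree_weight f"
    by (simp only: L(2)) (use code_labels_weight[of "[]" 0 f] in \<open>simp add: tree_weight_def\<close>)
qed

interpretation pgw: product_prob_space "\<lambda>_::nat list. measure_pmf (poisson_pmf 1)" UNIV
  by unfold_locales

lemma prob_space_pgw: "prob_space pgw_measure"
  unfolding pgw_measure_def by (rule pgw.prob_space_axioms)

lemma space_pgw [simp]: "space pgw_measure = UNIV"
  by (simp add: pgw_measure_def space_PiM)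

lemma pois_family_pgw: "pois_family pgw_measure (\<lambda>u c. c u)"
  unfolding pois_family_def
proof (intro allI impI)
  fix J :: "nat list set" and a
  assume J: "finite J"
  let ?A = "{c \<in> space pgw_measure. \<forall>y\<in>J. c y = a y}"
  have A: "?A = {c \<in> space pgw_measure. \<forall>y\<in>J. c y \<in> {a y}}" by simp
  have "emeasure pgw_measure ?A = (\<Prod>y\<in>J. ennreal (pois (a y)))"
    unfolding A unfolding pgw_measure_def using J
    by (subst pgw.emeasure_PiM_Collect) (auto simp: emeasure_pmf_single)
  then have "measure pgw_measure ?A = (\<Prod>y\<in>J. pois (a y))"
    by (simp add: measure_def prod_ennreal prod_nonneg)
  moreover have "?A \<in> sets pgw_measure"
    unfolding pgw_measure_def using J by measurable
  ultimately show "?A \<in> sets pgw_measure \<and> measure pgw_measure ?A = (\<Prod>y\<in>J. pois (a y))"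
    by simp
qed

text \<open>Disjointness of the events of coding different trees gives only a sum of at most one. By the
  branching structure the sum \<open>s\<close> satisfies \<open>s = exp (s - 1)\<close>, which forces \<open>s = 1\<close>.\<close>

definition total_tree_weight :: ennreal where
  "total_tree_weight = (\<integral>\<^sup>+f. tree_weight f \<partial>count_space UNIV)"

lemma total_tree_weight_le_1: "total_tree_weight \<le> 1"
proof -
  interpret prob_space pgw_measure by (rule prob_space_pgw)
  let ?E = "\<lambda>f. {c \<in> space pgw_measure. tree_coded c f}"
  note E = tree_coded_prob[OF pois_family_pgw]
  have "total_tree_weight = (\<integral>\<^sup>+f. emeasure pgw_measure (?E f) \<partial>count_space UNIV)"
    unfolding total_tree_weight_def using E(2) by (simp add: emeasure_eq_measure)
  also have "\<dots> = emeasure pgw_measure (\<Union>f. ?E f)"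
    using E(1) tree_coded_unique
    by (intro emeasure_UN_countable[symmetric]) (auto simp: disjoint_family_on_def)
  finally show ?thesis using emeasure_le_1[of "\<Union>f. ?E f"] by (simp only:)
qed

lemma bij_betw_Tree:
  "bij_betw (\<lambda>(f, g). Tree f g) (UNIV \<times> {g. width g = k}) {f. width f = Suc k}"
proof (rule bij_betwI')
  fix f assume "f \<in> {f. width f = Suc k}"
  then show "\<exists>x\<in>UNIV \<times> {g. width g = k}. f = (case x of (f, g) \<Rightarrow> Tree f g)"
    by (cases f) auto
qed auto

text \<open>A forest with \<open>k\<close> trees is a sequence of \<open>k\<close> free choices:
  \<open>bij_betw_Tree\<close> splits off the first tree and the weight factorizes.\<close>

lemma sum_forest_weight_width:
  "(\<integral>\<^sup>+f. ennreal (forest_weight f) \<partial>count_space {f. width f = k}) = total_tree_weight ^ k"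
proof (induction k)
  case 0
  have "{f. width f = 0} = {Void}"
  proof -
    have "width f = 0 \<longleftrightarrow> f = Void" for f by (cases f) auto
    then show ?thesis by auto
  qed
  then show ?case by (simp add: nn_integral_count_space_finite)
next
  case (Suc k)
  let ?W = "{g. width g = k}"
  have "(\<integral>\<^sup>+f. ennreal (forest_weight f) \<partial>count_space {f. width f = Suc k}) =
      (\<integral>\<^sup>+x. ennreal (forest_weight (case x of (f, g) \<Rightarrow> Tree f g)) \<partial>count_space (UNIV \<times> ?W))"
    by (rule nn_integral_bij_count_space[OF bij_betw_Tree, symmetric])
  also have "\<dots> = (\<integral>\<^sup>+x. ennreal (forest_weight (case x of (f, g) \<Rightarrow> Tree f g)) *
      indicator (UNIV \<times> ?W) x \<partial>count_space UNIV)"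
    by (rule nn_integral_count_space_indicator) simp
  also have "\<dots> = (\<integral>\<^sup>+f. \<integral>\<^sup>+g. ennreal (forest_weight (Tree f g)) * indicator (UNIV \<times> ?W) (f, g)
      \<partial>count_space UNIV \<partial>count_space UNIV)"
    by (subst nn_integral_fst_count_space[symmetric]) simp
  also have "\<dots> = (\<integral>\<^sup>+f. \<integral>\<^sup>+g. ennreal (tree_weight f) * (ennreal (forest_weight g) * indicator ?W g)
      \<partial>count_space UNIV \<partial>count_space UNIV)"
    using tree_weight_pos forest_weight_pos
    by (intro nn_integral_cong)
      (auto simp: forest_weight_Tree ennreal_mult less_imp_le split: split_indicator simp del: forest_weight.simps)
  also have "\<dots> = (\<integral>\<^sup>+f. ennreal (tree_weight f) * total_tree_weight ^ k \<partial>count_space UNIV)"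
    using Suc.IH by (simp add: nn_integral_cmult nn_integral_count_space_indicator)
  also have "\<dots> = total_tree_weight ^ Suc k"
    by (simp add: nn_integral_multc total_tree_weight_def)
  finally show ?case .
qed

lemma total_tree_weight: "total_tree_weight = 1"
proof -
  define s where "s = enn2real total_tree_weight"
  \<comment> \<open>Here the bound by one is essential: infinity satisfies the same fixed point
    equation.\<close>
  have fin: "total_tree_weight = ennreal s" and s: "0 \<le> s"
    using neq_top_trans[OF _ total_tree_weight_le_1] by (simp_all add: s_def top.not_eq_extremum)
  \<comment> \<open>Sorting trees by the number of branches at the root yields the Poisson
    generating function at \<open>s\<close>.\<close>
  have "total_tree_weight = (\<integral>\<^sup>+f. \<integral>\<^sup>+k. ennreal (tree_weight f) * indicator {width f} k
      \<partial>count_space UNIV \<partial>count_space UNIV)"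
    unfolding total_tree_weight_def by (simp add: nn_integral_cmult)
  also have "\<dots> = (\<integral>\<^sup>+k. \<integral>\<^sup>+f. ennreal (tree_weight f) * indicator {width f} k
      \<partial>count_space UNIV \<partial>count_space UNIV)"
    using nn_integral_fst_count_space[of "\<lambda>(f, k). ennreal (tree_weight f) * indicator {width f} k"]
      nn_integral_snd_count_space[of "\<lambda>(f, k). ennreal (tree_weight f) * indicator {width f} k"]
    by simp
  also have "\<dots> = (\<integral>\<^sup>+k. ennreal (pois k) * total_tree_weight ^ k \<partial>count_space UNIV)"
  proof (rule nn_integral_cong)
    fix k
    have "(\<integral>\<^sup>+f. ennreal (tree_weight f) * indicator {width f} k \<partial>count_space UNIV) =
        (\<integral>\<^sup>+f. ennreal (pois k) * (ennreal (forest_weight f) * indicator {f. width f = k} f) \<partial>count_space UNIV)"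
      using forest_weight_pos
      by (intro nn_integral_cong)
        (auto simp: tree_weight_def ennreal_mult less_imp_le split: split_indicator simp del: pmf_poisson)
    also have "\<dots> = ennreal (pois k) * total_tree_weight ^ k"
      using sum_forest_weight_width[of k]
      by (simp add: nn_integral_cmult nn_integral_count_space_indicator del: pmf_poisson)
    finally show "(\<integral>\<^sup>+f. ennreal (tree_weight f) * indicator {width f} k \<partial>count_space UNIV) =
      ennreal (pois k) * total_tree_weight ^ k" .
  qed
  also have "\<dots> = (\<integral>\<^sup>+k. ennreal (pois k * s ^ k) \<partial>count_space UNIV)"
    using s by (intro nn_integral_cong) (simp add: fin ennreal_power ennreal_mult del: pmf_poisson)
  also have "\<dots> = (\<Sum>k. ennreal (pois k * s ^ k))"
    by (rule nn_integral_count_space_nat)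
  also have "\<dots> = ennreal (exp (s - 1))"
  proof (rule suminf_ennreal_eq)
    have "(\<lambda>k. exp (-1) * (s ^ k /\<^sub>R fact k)) sums (exp (-1) * exp s)"
      by (intro sums_mult exp_converges)
    moreover have "(\<lambda>k. exp (-1) * (s ^ k /\<^sub>R fact k)) = (\<lambda>k. pois k * s ^ k)"
      by (simp add: fun_eq_iff field_simps)
    ultimately show "(\<lambda>k. pois k * s ^ k) sums exp (s - 1)"
      by (simp add: exp_diff exp_minus field_simps)
  qed (use s in simp)
  finally have "s = exp (s - 1)"
    using s unfolding fin by (subst (asm) ennreal_inj) auto
  \<comment> \<open>The exponential lies strictly above its tangent at 0 away from 0, so
    \<open>s < exp (s - 1)\<close> unless \<open>s = 1\<close>.\<close>
  then have "s = 1"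
    using exp_minus_greater[of "1 - s"] by (cases "s = 1") auto
  with fin show ?thesis by simp
qed

section \<open>Laws of trees and marked trees, and transfer of such laws to events\<close>

definition gw_pmf :: "forest pmf" where
  "gw_pmf = embed_pmf tree_weight"

lemma pmf_gw_pmf: "pmf gw_pmf f = tree_weight f"
  unfolding gw_pmf_def using total_tree_weight tree_weight_pos
  by (intro pmf_embed_pmf) (auto simp: total_tree_weight_def less_imp_le)

text \<open>The spine branch sits at a uniform position: an ancestor with \<open>k + 1\<close> children has probability
  \<open>exp (- 1) / fact (k + 1)\<close>, and its \<open>k + 1\<close> possible positions add up to \<open>pois k\<close>.\<close>

definition marked_pmf :: "(forest \<times> nat) pmf" where
  "marked_pmf = bind_pmf gw_pmf (\<lambda>f. map_pmf (Pair f) (pmf_of_set {..width f}))"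

lemma pmf_marked_pmf:
  "pmf marked_pmf (f, j) = (if j \<le> width f then tree_weight f / Suc (width f) else 0)"
proof -
  have "pmf (map_pmf (Pair g) (pmf_of_set {..width g})) (f, j) =
      indicator {f} g * pmf (pmf_of_set {..width f}) j" for g
  proof (cases "g = f")
    case True
    then show ?thesis using pmf_map_inj'[of "Pair f" "pmf_of_set {..width f}" j] by (simp add: inj_def)
  next
    case False
    then show ?thesis by (auto simp: pmf_eq_0_set_pmf)
  qed
  then have "pmf marked_pmf (f, j) = pmf gw_pmf f * pmf (pmf_of_set {..width f}) j"
    by (simp add: marked_pmf_def pmf_bind measure_pmf_single)
  then show ?thesis by (simp add: pmf_gw_pmf)
qed

lemma map_fst_marked_pmf: "map_pmf fst marked_pmf = gw_pmf"
  by (simp add: marked_pmf_def map_bind_pmf pmf.map_comp o_def map_pmf_const bind_return_pmf')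

lemma pmf_replicate_Cons:
  "pmf (replicate_pmf (Suc n) p) (x # xs) = pmf p x * pmf (replicate_pmf n p) xs"
proof -
  have "replicate_pmf (Suc n) p = map_pmf (\<lambda>(x, xs). x # xs) (pair_pmf p (replicate_pmf n p))"
    by (simp add: pair_pmf_def map_bind_pmf)
  moreover have "inj (\<lambda>(x, xs). x # xs)" by (auto simp: inj_def)
  ultimately show ?thesis
    using pmf_map_inj'[of "\<lambda>(x, xs). x # xs" "pair_pmf p (replicate_pmf n p)" "(x, xs)"]
    by (simp only: pmf_pair prod.case)
qed

lemma map_replicate_pmf: "map_pmf (map h) (replicate_pmf n p) = replicate_pmf n (map_pmf h p)"
proof (induction n)
  case (Suc n)
  show ?case by (simp only: replicate_pmf.simps flip: Suc.IH) (simp add: map_bind_pmf bind_map_pmf)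
qed simp

lemma pmf_replicate_length: "length xs \<noteq> n \<Longrightarrow> pmf (replicate_pmf n p) xs = 0"
  by (simp add: pmf_eq_0_set_pmf set_replicate_pmf)

text \<open>Disjoint events whose probabilities add up to one exhaust the space almost surely. An
  event decided by the index \<open>x\<close> on each piece thus inherits its probability from
  \<open>Q\<close>.\<close>

lemma measure_by_pmf:
  fixes E :: "'x::countable \<Rightarrow> 'a set"
  assumes "prob_space M" "\<And>x. E x \<in> sets M" "\<And>x. measure M (E x) = pmf Q x"
    and disj: "\<And>x y \<omega>. \<omega> \<in> E x \<Longrightarrow> \<omega> \<in> E y \<Longrightarrow> x = y"
  shows "AE \<omega> in M. \<exists>x. \<omega> \<in> E x"
    and "A \<in> sets M \<Longrightarrow> (\<And>x \<omega>. \<omega> \<in> E x \<Longrightarrow> \<omega> \<in> A \<longleftrightarrow> p x) \<Longrightarrow>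
      measure M A = measure_pmf.prob Q {x. p x}"
proof -
  interpret prob_space M by fact
  have sum: "measure M (\<Union>x\<in>S. E x) = measure_pmf.prob Q S" for S
  proof -
    have "emeasure M (\<Union>x\<in>S. E x) = (\<integral>\<^sup>+x. emeasure M (E x) \<partial>count_space S)"
      using assms(2) disj by (intro emeasure_UN_countable) (auto simp: disjoint_family_on_def)
    also have "\<dots> = emeasure (measure_pmf Q) S"
      by (simp add: emeasure_eq_measure assms(3) nn_integral_pmf)
    finally show ?thesis by (simp add: measure_def)
  qed
  have ev: "(\<Union>x\<in>S. E x) \<in> sets M" for S
    using assms(2) by (intro sets.countable_UN') auto
  have "prob (\<Union>x\<in>UNIV. E x) = 1" by (simp only: sum) simp
  with ev[of UNIV] have AE: "AE \<omega> in M. \<omega> \<in> (\<Union>x\<in>UNIV. E x)" by (rule prob_eq_1[THEN iffD1])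
  then show "AE \<omega> in M. \<exists>x. \<omega> \<in> E x" by simp
  assume A: "A \<in> sets M" and p: "\<And>x \<omega>. \<omega> \<in> E x \<Longrightarrow> \<omega> \<in> A \<longleftrightarrow> p x"
  have "measure M A = measure M (\<Union>x\<in>{x. p x}. E x)"
    using AE A p by (intro measure_eq_AE ev) auto
  with sum show "measure M A = measure_pmf.prob Q {x. p x}" by simp
qed

subsection \<open>Neighborhoods\<close>

lemma rooted_iso_trans:
  assumes "rooted_iso A B" "rooted_iso B C"
  shows "rooted_iso A C"
proof -
  obtain G a where A: "A = (G, a)" by (cases A)
  obtain H b where B: "B = (H, b)" by (cases B)
  obtain K c where C: "C = (K, c)" by (cases C)
  obtain \<phi> where \<phi>: "bij_betw \<phi> (verts G) (verts H)" "\<phi> a = b"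
    "\<forall>u\<in>verts G. \<forall>v\<in>verts G. {u, v} \<in> edges G \<longleftrightarrow> {\<phi> u, \<phi> v} \<in> edges H"
    using assms(1) unfolding A B rooted_iso_def by auto
  obtain \<psi> where \<psi>: "bij_betw \<psi> (verts H) (verts K)" "\<psi> b = c"
    "\<forall>u\<in>verts H. \<forall>v\<in>verts H. {u, v} \<in> edges H \<longleftrightarrow> {\<psi> u, \<psi> v} \<in> edges K"
    using assms(2) unfolding B C rooted_iso_def by auto
  have "\<phi> u \<in> verts H" if "u \<in> verts G" for u
    using that \<phi>(1) by (rule bij_betw_apply[rotated])
  then have "bij_betw (\<psi> \<circ> \<phi>) (verts G) (verts K) \<and> (\<psi> \<circ> \<phi>) a = c \<and>
    (\<forall>u\<in>verts G. \<forall>v\<in>verts G. {u, v} \<in> edges G \<longleftrightarrow> {(\<psi> \<circ> \<phi>) u, (\<psi> \<circ> \<phi>) v} \<in> edges K)"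
    using \<phi> \<psi> bij_betw_trans by auto
  then show ?thesis unfolding A C rooted_iso_def by blast
qed

lemma walk_nth:
  "walk G xs \<longleftrightarrow> xs \<noteq> [] \<and> set xs \<subseteq> verts G \<and>
    (\<forall>i. Suc i < length xs \<longrightarrow> {xs ! i, xs ! Suc i} \<in> edges G)"
  by (simp add: walk_def successively_conv_nth)

lemma walk_in_ball:
  assumes "walk G xs" "hd xs = a" "length xs \<le> Suc r"
  shows "set xs \<subseteq> ball_verts r (G, a)"
proof
  fix x assume "x \<in> set xs"
  then obtain i where i: "i < length xs" "xs ! i = x" by (auto simp: in_set_conv_nth)
  have "walk G (take (Suc i) xs)"
    using assms(1) set_take_subset[of "Suc i" xs] unfolding walk_nth by auto
  moreover have "hd (take (Suc i) xs) = a" using assms i by (simp add: hd_take)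
  moreover have "last (take (Suc i) xs) = x" using i by (simp add: take_Suc_conv_app_nth)
  moreover have "length (take (Suc i) xs) \<le> Suc r" using assms(3) by simp
  ultimately show "x \<in> ball_verts r (G, a)" unfolding ball_verts_def by blast
qed

lemma ball_verts_map:
  assumes "ball_verts r (G, a) \<subseteq> V" "\<psi> ` V \<subseteq> verts G'"
    and "\<And>u v. u \<in> V \<Longrightarrow> v \<in> V \<Longrightarrow> {u, v} \<in> edges G \<Longrightarrow> {\<psi> u, \<psi> v} \<in> edges G'"
  shows "\<psi> ` ball_verts r (G, a) \<subseteq> ball_verts r (G', \<psi> a)"
proof
  fix y assume "y \<in> \<psi> ` ball_verts r (G, a)"
  then obtain xs where xs: "walk G xs" "hd xs = a" "y = \<psi> (last xs)" "length xs \<le> Suc r"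
    by (auto simp: ball_verts_def)
  have V: "set xs \<subseteq> V" using walk_in_ball[OF xs(1,2,4)] assms(1) by simp
  have "walk G' (map \<psi> xs)"
    using xs(1) V assms(2,3) unfolding walk_nth by (auto simp: subset_iff)
  moreover have "hd (map \<psi> xs) = \<psi> a" "last (map \<psi> xs) = y"
    using xs by (auto simp: walk_def hd_map last_map)
  ultimately show "y \<in> ball_verts r (G', \<psi> a)"
    using xs(4) unfolding ball_verts_def by (auto intro!: exI[of _ "map \<psi> xs"])
qed

text \<open>The bijection is only given on sets containing the two balls. Walks of length at most
  \<open>r\<close> from the root never leave these sets, so they can be carried over in both
  directions.\<close>

lemma neighborhood_iso:
  assumes \<psi>: "bij_betw \<psi> V V'" and V: "V \<subseteq> verts G" "V' \<subseteq> verts G'" "a \<in> V"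
    and e: "\<And>u v. u \<in> V \<Longrightarrow> v \<in> V \<Longrightarrow> {u, v} \<in> edges G \<longleftrightarrow> {\<psi> u, \<psi> v} \<in> edges G'"
    and b: "ball_verts r (G, a) \<subseteq> V" "ball_verts r (G', \<psi> a) \<subseteq> V'"
  shows "rooted_iso (neighborhood r (G, a)) (neighborhood r (G', \<psi> a))"
proof -
  let ?B = "ball_verts r (G, a)" and ?B' = "ball_verts r (G', \<psi> a)" and ?\<rho> = "inv_into V \<psi>"
  have \<rho>: "bij_betw ?\<rho> V' V" using \<psi> by (rule bij_betw_inv_into)
  have \<psi>\<rho>: "\<psi> (?\<rho> y) = y" "?\<rho> y \<in> V" if "y \<in> V'" for y
    using that \<psi> \<rho> by (auto simp: bij_betw_inv_into_right dest: bij_betw_apply)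
  have "\<psi> ` ?B \<subseteq> ?B'"
    using \<psi> V e by (intro ball_verts_map[OF b(1)]) (auto simp: bij_betw_def)
  have "?\<rho> ` ?B' \<subseteq> ball_verts r (G, ?\<rho> (\<psi> a))"
    using \<psi>\<rho> V e by (intro ball_verts_map[OF b(2)]) auto
  then have "?\<rho> ` ?B' \<subseteq> ?B" using \<psi> V(3) by (simp add: bij_betw_inv_into_left)
  have "?B' \<subseteq> \<psi> ` ?B"
  proof
    fix y assume y: "y \<in> ?B'"
    then have "\<psi> (?\<rho> y) = y" using b(2) by (intro \<psi>\<rho>(1)) (rule subsetD)
    moreover have "?\<rho> y \<in> ?B" using \<open>?\<rho> ` ?B' \<subseteq> ?B\<close> y by (simp add: image_subset_iff)
    ultimately show "y \<in> \<psi> ` ?B" by (rule image_eqI[OF sym])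
  qed
  with \<open>\<psi> ` ?B \<subseteq> ?B'\<close> have "bij_betw \<psi> ?B ?B'"
    using \<psi> b(1) by (auto simp: bij_betw_def intro: inj_on_subset)
  moreover have "{u, v} \<in> edges G \<and> {u, v} \<subseteq> ?B \<longleftrightarrow> {\<psi> u, \<psi> v} \<in> edges G' \<and> {\<psi> u, \<psi> v} \<subseteq> ?B'"
    if "u \<in> ?B" "v \<in> ?B" for u v
    using that e[of u v] b(1) \<open>\<psi> ` ?B \<subseteq> ?B'\<close> by blast
  ultimately show ?thesis
    unfolding rooted_iso_def neighborhood_def by auto
qed

lemma ball_verts_0: "ball_verts 0 (G, a) \<subseteq> {a}"
proof
  fix v assume "v \<in> ball_verts 0 (G, a)"
  then obtain xs where "xs \<noteq> []" "hd xs = a" "last xs = v" "length xs \<le> 1"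
    by (auto simp: ball_verts_def walk_def)
  then show "v \<in> {a}" by (cases xs) auto
qed

lemma ball_verts_Suc:
  "ball_verts (Suc r) (G, a) \<subseteq>
    ball_verts r (G, a) \<union> {v \<in> verts G. \<exists>u\<in>ball_verts r (G, a). {u, v} \<in> edges G}"
proof
  fix v assume "v \<in> ball_verts (Suc r) (G, a)"
  then obtain xs where xs: "walk G xs" "hd xs = a" "last xs = v" "length xs \<le> Suc (Suc r)"
    by (auto simp: ball_verts_def)
  show "v \<in> ball_verts r (G, a) \<union> {v \<in> verts G. \<exists>u\<in>ball_verts r (G, a). {u, v} \<in> edges G}"
  proof (cases "length xs \<le> Suc r")
    case True
    with xs show ?thesis by (auto simp: ball_verts_def)
  next
    case False
    obtain ys where ys: "xs = ys @ [v]"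
      using xs by (cases xs rule: rev_cases) (auto simp: walk_def)
    with False xs(4) have "ys \<noteq> []" "length ys \<le> Suc r" by auto
    with xs ys have "walk G ys" "hd ys = a" "{last ys, v} \<in> edges G" "v \<in> verts G"
      by (auto simp: walk_def successively_append_iff)
    with \<open>length ys \<le> Suc r\<close> show ?thesis by (auto simp: ball_verts_def)
  qed
qed

text \<open>\<open>g\<close> places an abstract spine in a concrete graph, with \<open>P\<close>
  orienting the edges inside its image. The image may exceed the ball, whose exact shape is never
  computed.\<close>

definition spine_rep ::
    "('v \<Rightarrow> 'v \<Rightarrow> bool) \<Rightarrow> 'v set \<Rightarrow> ('v \<Rightarrow> 'w) \<Rightarrow> nat \<Rightarrow> 'w graph \<Rightarrow> 'w \<Rightarrow> forest \<Rightarrow> forest list \<Rightarrow> bool" where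
  "spine_rep P D g r G a f0 fs \<longleftrightarrow> (\<exists>d t. is_spine P D d t f0 fs \<and> g d = a) \<and>
     inj_on g D \<and> g ` D \<subseteq> verts G \<and> ball_verts r (G, a) \<subseteq> g ` D \<and>
     (\<forall>u\<in>D. \<forall>v\<in>D. {g u, g v} \<in> edges G \<longleftrightarrow> P u v \<or> P v u)"

text \<open>By \<open>is_spine_iso\<close> the data \<open>f0\<close>, \<open>fs\<close> alone
  determine the neighborhood, whatever the vertex types are.\<close>

lemma spine_rep_iso:
  assumes "spine_rep P D g r G a f0 fs" "spine_rep P' D' g' r G' a' f0 fs"
  shows "rooted_iso (neighborhood r (G, a)) (neighborhood r (G', a'))"
proof -
  obtain d t where d: "is_spine P D d t f0 fs" "g d = a"
    using assms(1) by (auto simp: spine_rep_def)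
  obtain d' t' where d': "is_spine P' D' d' t' f0 fs" "g' d' = a'"
    using assms(2) by (auto simp: spine_rep_def)
  obtain \<phi> where \<phi>: "iso_on P D P' D' \<phi>" "\<phi> d = d'"
    using is_spine_iso[OF d(1) d'(1)] by blast
  have inj: "inj_on g D" "inj_on g' D'" using assms by (auto simp: spine_rep_def)
  define \<psi> where "\<psi> = g' \<circ> \<phi> \<circ> inv_into D g"
  have b: "bij_betw \<psi> (g ` D) (g' ` D')"
    unfolding \<psi>_def using inj \<phi>(1)
    by (intro bij_betw_trans[of _ _ D] bij_betw_trans[of _ _ D'])
      (auto simp: iso_on_def bij_betw_inv_into bij_betw_imageI)
  have \<psi>g: "\<psi> (g x) = g' (\<phi> x)" if "x \<in> D" for x
    using that inj by (simp add: \<psi>_def)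
  have dD: "d \<in> D" using is_spine_top[OF d(1)] by blast
  have "\<psi> a = a'" using \<psi>g[OF dD] d d' \<phi> by simp
  moreover have "rooted_iso (neighborhood r (G, a)) (neighborhood r (G', \<psi> a))"
  proof (rule neighborhood_iso[OF b])
    show "g ` D \<subseteq> verts G" "g' ` D' \<subseteq> verts G'" "ball_verts r (G, a) \<subseteq> g ` D"
      "ball_verts r (G', \<psi> a) \<subseteq> g' ` D'"
      using assms \<open>\<psi> a = a'\<close> by (auto simp: spine_rep_def)
    show "a \<in> g ` D" using d dD by blast
    fix u v assume "u \<in> g ` D" "v \<in> g ` D"
    then obtain x y where xy: "u = g x" "v = g y" "x \<in> D" "y \<in> D" by blast
    then have "\<phi> x \<in> D'" "\<phi> y \<in> D'"
      using \<phi>(1) by (auto simp: iso_on_def dest: bij_betw_apply)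
    with xy assms \<phi>(1) show "{u, v} \<in> edges G \<longleftrightarrow> {\<psi> u, \<psi> v} \<in> edges G'"
      by (simp add: \<psi>g spine_rep_def iso_on_def)
  qed
  ultimately show ?thesis by simp
qed

text \<open>Since \<open>H\<close> is finite, the event is a countable union over the possible balls
  and their edge relations. Balls are enumerated by lists \<open>F\<close>, because lists over a
  countable type are countable whereas arbitrary sets are not.\<close>

lemma neighborhood_iso_measurable:
  fixes G :: "'a \<Rightarrow> 'v::countable graph"
  assumes [measurable]: "\<And>v. Measurable.pred M (\<lambda>\<omega>. v \<in> verts (G \<omega>))"
    and [measurable]: "\<And>u v. Measurable.pred M (\<lambda>\<omega>. {u, v} \<in> edges (G \<omega>))"
    and H: "finite (verts H)"
  shows "{\<omega> \<in> space M. rooted_iso (neighborhood r (G \<omega>, a)) (H, b)} \<in> sets M"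
proof -
  define Q where "Q F W \<longleftrightarrow> (\<exists>\<phi>. bij_betw \<phi> F (verts H) \<and> \<phi> a = b \<and>
    (\<forall>u\<in>F. \<forall>v\<in>F. (u, v) \<in> W \<longleftrightarrow> {\<phi> u, \<phi> v} \<in> edges H))" for F W
  have [measurable]: "Measurable.pred M (\<lambda>\<omega>. v \<in> ball_verts r (G \<omega>, a))" for v
  proof -
    have [measurable]: "Measurable.pred M (\<lambda>\<omega>. walk (G \<omega>) xs)" for xs
    proof -
      have "walk (G \<omega>) xs \<longleftrightarrow> xs \<noteq> [] \<and> (\<forall>x\<in>set xs. x \<in> verts (G \<omega>)) \<and>
        (\<forall>i\<in>{i. Suc i < length xs}. {xs ! i, xs ! Suc i} \<in> edges (G \<omega>))" for \<omega>
        by (auto simp: walk_nth)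
      then show ?thesis by simp
    qed
    have "v \<in> ball_verts r (G \<omega>, a) \<longleftrightarrow>
      (\<exists>xs\<in>{xs. hd xs = a \<and> last xs = v \<and> length xs \<le> Suc r}. walk (G \<omega>) xs)" for \<omega>
      by (auto simp: ball_verts_def)
    then show ?thesis by simp
  qed
  have "rooted_iso (neighborhood r (G \<omega>, a)) (H, b) \<longleftrightarrow>
    (\<exists>F. \<exists>W\<in>Pow (set F \<times> set F). Q (set F) W \<and>
      (\<forall>v. v \<in> ball_verts r (G \<omega>, a) \<longleftrightarrow> v \<in> set F) \<and>
      (\<forall>x\<in>set F \<times> set F. {fst x, snd x} \<in> edges (G \<omega>) \<longleftrightarrow> x \<in> W))" (is "?l \<longleftrightarrow> ?r") for \<omega>
  proof
    let ?B = "ball_verts r (G \<omega>, a)"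
    let ?W = "{(u, v) \<in> ?B \<times> ?B. {u, v} \<in> edges (G \<omega>)}"
    assume ?l
    then obtain \<phi> where \<phi>: "bij_betw \<phi> ?B (verts H)" "\<phi> a = b"
      "\<forall>u\<in>?B. \<forall>v\<in>?B. {u, v} \<in> edges (G \<omega>) \<longleftrightarrow> {\<phi> u, \<phi> v} \<in> edges H"
      by (auto simp: rooted_iso_def neighborhood_def)
    then have "finite ?B" using H bij_betw_finite by blast
    moreover have "Q ?B ?W" unfolding Q_def using \<phi> by (intro exI[of _ \<phi>]) auto
    moreover obtain F where "set F = ?B" using finite_list[OF \<open>finite ?B\<close>] by blast
    ultimately show ?r by (intro exI[of _ F] bexI[of _ ?W]) auto
  next
    assume ?r
    then obtain F' W where "W \<subseteq> set F' \<times> set F'" "Q (set F') W"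
      "\<forall>v. v \<in> ball_verts r (G \<omega>, a) \<longleftrightarrow> v \<in> set F'"
      "\<forall>x\<in>set F' \<times> set F'. {fst x, snd x} \<in> edges (G \<omega>) \<longleftrightarrow> x \<in> W" by blast
    then obtain F where FW: "W \<subseteq> F \<times> F" "Q F W" "\<forall>v. v \<in> ball_verts r (G \<omega>, a) \<longleftrightarrow> v \<in> F"
      "\<forall>x\<in>F \<times> F. {fst x, snd x} \<in> edges (G \<omega>) \<longleftrightarrow> x \<in> W" by blast
    then have F: "ball_verts r (G \<omega>, a) = F" by blast
    obtain \<phi> where "bij_betw \<phi> F (verts H)" "\<phi> a = b"
      "\<forall>u\<in>F. \<forall>v\<in>F. (u, v) \<in> W \<longleftrightarrow> {\<phi> u, \<phi> v} \<in> edges H"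
      using FW(2) unfolding Q_def by blast
    with FW(4) show ?l
      unfolding rooted_iso_def neighborhood_def by (auto simp: F)
  qed
  moreover have "Measurable.pred M (\<lambda>\<omega>. \<exists>F. \<exists>W\<in>Pow (set F \<times> set F). Q (set F) W \<and>
      (\<forall>v. v \<in> ball_verts r (G \<omega>, a) \<longleftrightarrow> v \<in> set F) \<and>
      (\<forall>x\<in>set F \<times> set F. {fst x, snd x} \<in> edges (G \<omega>) \<longleftrightarrow> x \<in> W))"
    by (intro pred_intros_countable(2) pred_intros_finite(3,4) pred_intros_logic
      pred_intros_conj1' pred_intros_countable(1)) (simp_all, measurable)
  ultimately show ?thesis by (simp add: pred_def)
qed

subsection \<open>The incipient infinite cluster\<close>

abbreviation gw_nodes :: "(nat list \<Rightarrow> nat) \<Rightarrow> nat list set" where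
  "gw_nodes c \<equiv> verts (gw_tree c)"

lemma gw_nodes_def: "gw_nodes c = {u. \<forall>k < length u. u ! k < c (take k u)}"
  by (simp add: gw_tree_def Let_def)

lemma Nil_gw_nodes [simp]: "[] \<in> gw_nodes c"
  by (simp add: gw_nodes_def)

lemma snoc_gw_nodes: "u @ [k] \<in> gw_nodes c \<longleftrightarrow> u \<in> gw_nodes c \<and> k < c u"
  by (auto simp: gw_nodes_def nth_append less_Suc_eq)

lemma append_gw_nodes: "u @ w \<in> gw_nodes c \<Longrightarrow> u \<in> gw_nodes c"
  by (induction w rule: rev_induct) (auto simp: snoc_gw_nodes simp flip: append_assoc)

lemma append_Cons_gw_nodes: "u @ j # w \<in> gw_nodes c \<Longrightarrow> u \<in> gw_nodes c \<and> j < c u"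
  using append_gw_nodes[of "u @ [j]" w c] by (simp add: snoc_gw_nodes)

lemma edges_gw_tree:
  "{u, v} \<in> edges (gw_tree c) \<longleftrightarrow>
    (\<exists>k. v = u @ [k] \<and> v \<in> gw_nodes c) \<or> (\<exists>k. u = v @ [k] \<and> u \<in> gw_nodes c)"
proof -
  have "edges (gw_tree c) = {{u, u @ [i]} |u i. u @ [i] \<in> gw_nodes c}"
    by (simp add: gw_tree_def Let_def)
  then show ?thesis by (auto simp: doubleton_eq_iff)
qed

text \<open>Edges are oriented towards infinity, so along the path the next node is the parent. This
  matches \<open>par\<close>, whose ancestral lines play the part of the infinite path.\<close>

definition iic_par :: "nat \<times> nat list \<Rightarrow> nat \<times> nat list \<Rightarrow> bool" where
  "iic_par x y \<longleftrightarrow> (\<exists>i u k. x = (i, u @ [k]) \<and> y = (i, u)) \<or> (\<exists>i. x = (i, []) \<and> y = (Suc i, []))"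

definition branch_nodes ::
    "(nat \<Rightarrow> nat list \<Rightarrow> nat) \<Rightarrow> nat \<Rightarrow> nat list \<Rightarrow> nat \<Rightarrow> (nat \<times> nat list) set" where
  "branch_nodes c i u k = {(i, u @ j # w) | j w. k \<le> j \<and> u @ j # w \<in> gw_nodes (c i)}"

lemma verts_iic: "verts (iic_tree c) = {(i, u). u \<in> gw_nodes (c i)}"
  by (simp add: iic_tree_def)

lemma edges_iic:
  assumes "x \<in> verts (iic_tree c)" "y \<in> verts (iic_tree c)"
  shows "{x, y} \<in> edges (iic_tree c) \<longleftrightarrow> iic_par x y \<or> iic_par y x"
proof -
  obtain i u j v where xy: "x = (i, u)" "y = (j, v)" by fastforce
  have "{x, y} \<in> edges (iic_tree c) \<longleftrightarrow>
    (i = j \<and> {u, v} \<in> edges (gw_tree (c i))) \<or> (u = [] \<and> v = [] \<and> (j = Suc i \<or> i = Suc j))"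
    unfolding xy iic_tree_def by (auto simp: doubleton_eq_iff insert_commute)
  also have "\<dots> \<longleftrightarrow> iic_par x y \<or> iic_par y x"
    using assms unfolding xy edges_gw_tree iic_par_def verts_iic by auto
  finally show ?thesis .
qed

lemma glue_branch:
  assumes "v = (i, u @ [k])" "u \<in> gw_nodes (c i)" "k < c i u"
  shows "glue iic_par v (branch_nodes c i (u @ [k]) 0) {(i, u @ [k] @ [j]) |j. j < c i (u @ [k])}
      (branch_nodes c i u (Suc k)) {}"
    and "branch_nodes c i u k =
      insert v (branch_nodes c i (u @ [k]) 0 \<union> branch_nodes c i u (Suc k))"
proof -
  have v: "u @ [k] \<in> gw_nodes (c i)" using assms by (simp add: snoc_gw_nodes)
  have "j < c i (u @ [k])" if "u @ k # j # w \<in> gw_nodes (c i)" for j w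
    using append_Cons_gw_nodes[of "u @ [k]" j w "c i"] that by simp
  then show "glue iic_par v (branch_nodes c i (u @ [k]) 0) {(i, u @ [k] @ [j]) |j. j < c i (u @ [k])}
      (branch_nodes c i u (Suc k)) {}"
    unfolding glue_def branch_nodes_def assms(1) iic_par_def
    by (auto simp: append_eq_append_conv2 append_eq_Cons_conv Cons_eq_append_conv)
  show "branch_nodes c i u k =
      insert v (branch_nodes c i (u @ [k]) 0 \<union> branch_nodes c i u (Suc k))" (is "?l = ?r")
  proof
    show "?l \<subseteq> ?r"
    proof
      fix x assume "x \<in> ?l"
      then obtain j w where x: "x = (i, u @ j # w)" "k \<le> j" "u @ j # w \<in> gw_nodes (c i)"
        by (auto simp: branch_nodes_def)
      show "x \<in> ?r"
        using x unfolding branch_nodes_def assms(1) by (cases "j = k"; cases w) auto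
    qed
    show "?r \<subseteq> ?l"
      using v unfolding branch_nodes_def assms(1) by auto
  qed
qed

text \<open>Counterpart of \<open>matches_forest_is_forest\<close> for Ulam-Harris words. The width
  hypothesis ensures that no branches are left when the forest is used up.\<close>

lemma coded_is_forest:
  assumes "u \<in> gw_nodes (c i)" "k + width f = c i u" "coded (c i) u k f"
  shows "is_forest iic_par (branch_nodes c i u k) {(i, u @ [j]) |j. k \<le> j \<and> j < c i u} f"
  using assms
proof (induction f arbitrary: u k)
  case Void
  then show ?case using append_Cons_gw_nodes by (fastforce simp: branch_nodes_def)
next
  case (Tree f g)
  let ?v = "(i, u @ [k])"
  have k: "k < c i u" using Tree.prems by simp
  have "is_forest iic_par (branch_nodes c i (u @ [k]) 0)
      {(i, (u @ [k]) @ [j]) |j. 0 \<le> j \<and> j < c i (u @ [k])} f"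
    using Tree.prems k by (intro Tree.IH(1)) (auto simp: snoc_gw_nodes)
  then have 1: "is_forest iic_par (branch_nodes c i (u @ [k]) 0)
      {(i, u @ [k] @ [j]) |j. j < c i (u @ [k])} f" by simp
  have 2: "is_forest iic_par (branch_nodes c i u (Suc k)) {(i, u @ [j]) |j. Suc k \<le> j \<and> j < c i u} g"
    using Tree.prems by (intro Tree.IH(2)) auto
  have R: "{(i, u @ [j]) |j. k \<le> j \<and> j < c i u} =
      insert ?v {(i, u @ [j]) |j. Suc k \<le> j \<and> j < c i u}"
    using k by (auto simp: Suc_le_eq order_le_less)
  note glue = glue_branch[where c = c, OF refl[of ?v] Tree.prems(1) k]
  show ?case
    unfolding is_forest.simps using 1 2 glue R by blast
qed

definition iic_level :: "(nat \<Rightarrow> nat list \<Rightarrow> nat) \<Rightarrow> nat \<Rightarrow> (nat \<times> nat list) set" where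
  "iic_level c n = {(i, u). i \<le> n \<and> u \<in> gw_nodes (c i)}"

fun iic_coded :: "(nat \<Rightarrow> nat list \<Rightarrow> nat) \<Rightarrow> forest \<Rightarrow> forest list \<Rightarrow> bool" where
  "iic_coded c f0 [] \<longleftrightarrow> tree_coded (c 0) f0"
| "iic_coded c f0 (f # fs) \<longleftrightarrow> tree_coded (c (Suc (length fs))) f \<and> iic_coded c f0 fs"

lemma tree_coded_is_forest:
  assumes "tree_coded (c i) f"
  shows "is_forest iic_par (branch_nodes c i [] 0) {(i, [j]) |j. j < c i []} f"
  using coded_is_forest[of "[]" c i 0 f] assms by (simp add: tree_coded_def)

lemma branch_nodes_Nil: "branch_nodes c i [] 0 = {(i, u) |u. u \<noteq> [] \<and> u \<in> gw_nodes (c i)}"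
  unfolding branch_nodes_def by (auto simp: neq_Nil_conv)

lemma iic_coded_is_spine:
  "iic_coded c f0 fs \<Longrightarrow> is_spine iic_par (iic_level c (length fs)) (0, []) (length fs, []) f0 fs"
proof (induction fs)
  case Nil
  let ?D = "branch_nodes c 0 [] 0" and ?R = "{(0::nat, [j]) |j. j < c 0 []}"
  have "is_forest iic_par ?D ?R f0"
    using tree_coded_is_forest Nil by simp
  moreover have "glue iic_par (0, []) ?D ?R {} {}"
    unfolding glue_def branch_nodes_Nil iic_par_def
    using append_Cons_gw_nodes[of "[]" _ "[]" "c 0"] by auto
  moreover have "iic_level c 0 = insert (0, []) ?D"
    unfolding iic_level_def branch_nodes_Nil by auto
  ultimately show ?case by auto
next
  case (Cons f fs)
  let ?n = "Suc (length fs)"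
  let ?D = "branch_nodes c ?n [] 0" and ?R = "{(?n, [j]) |j. j < c ?n []}"
  have "is_forest iic_par ?D ?R f" "is_spine iic_par (iic_level c (length fs)) (0, []) (length fs, []) f0 fs"
    using tree_coded_is_forest[of c ?n f] Cons by simp_all
  moreover have "glue iic_par (?n, []) (iic_level c (length fs)) {(length fs, [])} ?D ?R"
    unfolding glue_def branch_nodes_Nil iic_par_def iic_level_def
    using append_Cons_gw_nodes[of "[]" _ "[]" "c ?n"] by auto
  moreover have "iic_level c ?n = insert (?n, []) (iic_level c (length fs) \<union> ?D)"
    unfolding iic_level_def branch_nodes_Nil by (auto simp: le_Suc_eq)
  ultimately have "is_spine iic_par (iic_level c ?n) (0, []) (?n, []) f0 (f # fs)"
    unfolding is_spine.simps by blast
  then show ?case by (simp only: length_Cons)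
qed

text \<open>The only edge leaving \<open>iic_level c r\<close> goes from \<open>(r, [])\<close> to
  the next node of the path, so each step gains at most one level.\<close>

lemma ball_iic: "ball_verts r (iic_rooted c) \<subseteq> iic_level c r"
  unfolding iic_rooted_def
proof (induction r)
  case 0
  show ?case using ball_verts_0[of "iic_tree c" "(0, [])"] by (auto simp: iic_level_def)
next
  case (Suc r)
  have "v \<in> iic_level c (Suc r)"
    if "u \<in> iic_level c r" "{u, v} \<in> edges (iic_tree c)" "v \<in> verts (iic_tree c)" for u v
  proof -
    have "u \<in> verts (iic_tree c)" using that(1) by (auto simp: iic_level_def verts_iic)
    then have "iic_par u v \<or> iic_par v u" using edges_iic that by blast
    with that(1,3) show ?thesis
      by (auto simp: iic_par_def iic_level_def verts_iic)
  qed
  moreover have "iic_level c r \<subseteq> iic_level c (Suc r)" by (auto simp: iic_level_def)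
  ultimately show ?case
    using ball_verts_Suc[of r "iic_tree c" "(0, [])"] Suc.IH by blast
qed

lemma iic_coded_spine_rep:
  assumes "iic_coded c f0 fs" "length fs = r"
  shows "spine_rep iic_par (iic_level c r) id r (iic_tree c) (0, []) f0 fs"
proof -
  have "iic_level c r \<subseteq> verts (iic_tree c)" by (auto simp: iic_level_def verts_iic)
  moreover have "{id x, id y} \<in> edges (iic_tree c) \<longleftrightarrow> iic_par x y \<or> iic_par y x"
    if "x \<in> iic_level c r" "y \<in> iic_level c r" for x y
    using edges_iic[of x c y] calculation that by auto
  moreover have "\<exists>d t. is_spine iic_par (iic_level c r) d t f0 fs \<and> id d = (0, [])"
    using iic_coded_is_spine[OF assms(1)] assms(2) by auto
  ultimately show ?thesis
    using ball_iic[of r c] unfolding spine_rep_def iic_rooted_def by simp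
qed

interpretation pgw_space: prob_space pgw_measure
  by (rule prob_space_pgw)

interpretation iic: product_prob_space "\<lambda>_::nat. pgw_measure" UNIV
  by unfold_locales

lemma prob_space_iic: "prob_space iic_measure"
  unfolding iic_measure_def by (rule iic.prob_space_axioms)

lemma space_iic [simp]: "space iic_measure = UNIV"
  by (simp add: iic_measure_def space_PiM)

fun spine_level :: "forest \<Rightarrow> forest list \<Rightarrow> nat \<Rightarrow> forest" where
  "spine_level f0 [] i = f0"
| "spine_level f0 (f # fs) i = (if i = Suc (length fs) then f else spine_level f0 fs i)"

lemma iic_coded_iff: "iic_coded c f0 fs \<longleftrightarrow> (\<forall>i\<le>length fs. tree_coded (c i) (spine_level f0 fs i))"
  by (induction fs) (auto simp: le_Suc_eq)

lemma iic_coded_unique: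
  "iic_coded c f0 fs \<Longrightarrow> iic_coded c f0' fs' \<Longrightarrow> length fs = length fs' \<Longrightarrow> f0 = f0' \<and> fs = fs'"
proof (induction fs arbitrary: fs')
  case Nil
  then show ?case using tree_coded_unique by auto
next
  case (Cons f fs)
  then obtain g gs where "fs' = g # gs" by (cases fs') auto
  with Cons show ?case using tree_coded_unique by auto
qed

lemma iic_coded_prob:
  shows "{c. iic_coded c f0 fs} \<in> sets iic_measure"
    and "measure iic_measure {c. iic_coded c f0 fs} = tree_weight f0 * prod_list (map tree_weight fs)"
proof -
  let ?X = "\<lambda>i. {d \<in> space pgw_measure. tree_coded d (spine_level f0 fs i)}"
  have X: "?X i \<in> sets pgw_measure" "measure pgw_measure (?X i) = tree_weight (spine_level f0 fs i)" for i
    using tree_coded_prob[OF pois_family_pgw] by auto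
  have eq: "{c. iic_coded c f0 fs} = {c \<in> space (Pi\<^sub>M UNIV (\<lambda>_. pgw_measure)). \<forall>i\<in>{..length fs}. c i \<in> ?X i}"
    by (auto simp: iic_coded_iff space_PiM)
  have "{c \<in> space (Pi\<^sub>M UNIV (\<lambda>_. pgw_measure)). \<forall>i\<in>{..length fs}. c i \<in> ?X i}
      \<in> sets (Pi\<^sub>M UNIV (\<lambda>_. pgw_measure))"
    using X by measurable
  then show "{c. iic_coded c f0 fs} \<in> sets iic_measure"
    unfolding eq iic_measure_def .
  have "emeasure iic_measure {c. iic_coded c f0 fs} = (\<Prod>i\<le>length fs. emeasure pgw_measure (?X i))"
    unfolding eq iic_measure_def using X by (intro iic.emeasure_PiM_Collect) auto
  also have "\<dots> = ennreal (\<Prod>i\<le>length fs. tree_weight (spine_level f0 fs i))"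
    using tree_weight_pos by (simp add: pgw_space.emeasure_eq_measure X(2)[simplified] prod_ennreal less_imp_le)
  also have "(\<Prod>i\<le>length fs. tree_weight (spine_level f0 fs i)) = tree_weight f0 * prod_list (map tree_weight fs)"
  proof (induction fs)
    case (Cons f fs)
    have "(\<Prod>i\<le>length fs. tree_weight (spine_level f0 (f # fs) i)) = (\<Prod>i\<le>length fs. tree_weight (spine_level f0 fs i))"
      by (intro prod.cong) auto
    with Cons show ?case by simp
  qed simp
  finally show "measure iic_measure {c. iic_coded c f0 fs} = tree_weight f0 * prod_list (map tree_weight fs)"
    by (rule measure_eq_emeasure_eq_ennreal[rotated])
      (use tree_weight_pos in \<open>auto intro!: mult_nonneg_nonneg prod_list_nonneg simp: less_imp_le\<close>)
qed

text \<open>A realization exists because the event has positive probability.\<close>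

lemma iic_coded_exists: "\<exists>c. iic_coded c f0 fs"
proof (rule ccontr)
  assume "\<nexists>c. iic_coded c f0 fs"
  then have "tree_weight f0 * prod_list (map tree_weight fs) = 0"
    using iic_coded_prob(2)[of f0 fs] by simp
  then show False using tree_weight_pos by (auto simp: prod_list_zero_iff less_le)
qed

definition spine_pmf :: "nat \<Rightarrow> (forest \<times> forest list) pmf" where
  "spine_pmf r = pair_pmf gw_pmf (replicate_pmf r gw_pmf)"

lemma pmf_replicate: "pmf (replicate_pmf n p) xs = (if length xs = n then prod_list (map (pmf p) xs) else 0)"
proof (induction n arbitrary: xs)
  case 0
  then show ?case by (cases xs) auto
next
  case (Suc n)
  then show ?case
    by (cases xs) (simp_all add: pmf_replicate_Cons pmf_replicate_length del: replicate_pmf.simps)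
qed

text \<open>By \<open>spine_rep_iso\<close> the choice of \<open>c\<close> does not matter.\<close>

definition nbhd_event :: "nat \<Rightarrow> nat graph \<Rightarrow> nat \<Rightarrow> (forest \<times> forest list) \<Rightarrow> bool" where
  "nbhd_event r H b x \<longleftrightarrow> (\<exists>c. iic_coded c (fst x) (snd x) \<and>
     rooted_iso (neighborhood r (iic_rooted c)) (H, b))"

text \<open>The same predicate on shapes decides the neighborhood event in both models; only the
  laws of the shapes remain to be compared.\<close>

lemma spine_rep_nbhd_event:
  assumes "spine_rep P D g r G a f0 fs" "length fs = r"
  shows "rooted_iso (neighborhood r (G, a)) (H, b) \<longleftrightarrow> nbhd_event r H b (f0, fs)"
proof
  assume 1: "rooted_iso (neighborhood r (G, a)) (H, b)"
  obtain c where c: "iic_coded c f0 fs" using iic_coded_exists by blast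
  have "rooted_iso (neighborhood r (iic_rooted c)) (neighborhood r (G, a))"
    unfolding iic_rooted_def using iic_coded_spine_rep[OF c assms(2)] assms(1) by (rule spine_rep_iso)
  from rooted_iso_trans[OF this 1] c show "nbhd_event r H b (f0, fs)"
    by (auto simp: nbhd_event_def)
next
  assume "nbhd_event r H b (f0, fs)"
  then obtain c where c: "iic_coded c f0 fs" "rooted_iso (neighborhood r (iic_rooted c)) (H, b)"
    by (auto simp: nbhd_event_def)
  have "rooted_iso (neighborhood r (G, a)) (neighborhood r (iic_rooted c))"
    unfolding iic_rooted_def using assms(1) iic_coded_spine_rep[OF c(1) assms(2)] by (rule spine_rep_iso)
  from rooted_iso_trans[OF this c(2)] show "rooted_iso (neighborhood r (G, a)) (H, b)" .
qed

lemma iic_nbhd_law: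
  assumes H: "finite (verts H)"
  shows "measure iic_measure {c \<in> space iic_measure. rooted_iso (neighborhood r (iic_rooted c)) (H, b)} =
    measure_pmf.prob (spine_pmf r) {x. nbhd_event r H b x}"
proof -
  let ?A = "{c \<in> space iic_measure. rooted_iso (neighborhood r (iic_rooted c)) (H, b)}"
  \<comment> \<open>Lists of the wrong length get the empty event, in agreement with their zero mass
    under \<open>replicate_pmf\<close>.\<close>
  define E where "E x = (if length (snd x) = r then {c. iic_coded c (fst x) (snd x)} else {})"
    for x :: "forest \<times> forest list"
  show ?thesis
  proof (rule measure_by_pmf(2)[of _ E])
    show "E x \<in> sets iic_measure" for x
      using iic_coded_prob(1) by (simp add: E_def)
    show "measure iic_measure (E x) = pmf (spine_pmf r) x" for x
      using iic_coded_prob(2)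
      by (cases x) (simp add: E_def spine_pmf_def pmf_pair pmf_gw_pmf[abs_def] pmf_replicate)
    show "x = y" if "c \<in> E x" "c \<in> E y" for x y c
      using that iic_coded_unique[of c "fst x" "snd x" "fst y" "snd y"]
      by (auto simp: E_def prod_eq_iff split: if_splits)
    have [measurable]: "(\<lambda>c. c i u) \<in> iic_measure \<rightarrow>\<^sub>M count_space UNIV" for i u
    proof -
      have "(\<lambda>c. c i) \<in> iic_measure \<rightarrow>\<^sub>M pgw_measure"
        unfolding iic_measure_def by (rule measurable_component_singleton) simp
      moreover have "(\<lambda>d. d u) \<in> pgw_measure \<rightarrow>\<^sub>M measure_pmf (poisson_pmf 1)"
        unfolding pgw_measure_def by (rule measurable_component_singleton) simp
      ultimately have "(\<lambda>c. c i u) \<in> iic_measure \<rightarrow>\<^sub>M measure_pmf (poisson_pmf 1)"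
        by (rule measurable_compose)
      then show ?thesis
        using measurable_cong_sets[OF refl, of "measure_pmf (poisson_pmf 1)" "count_space UNIV" iic_measure]
        by simp
    qed
    have [measurable]: "Measurable.pred iic_measure (\<lambda>c. u \<in> gw_nodes (c i))" for u i
      unfolding gw_nodes_def mem_Collect_eq by measurable
    have v: "Measurable.pred iic_measure (\<lambda>c. x \<in> verts (iic_tree c))" for x
      unfolding verts_iic by (cases x) simp
    have e: "Measurable.pred iic_measure (\<lambda>c. {x, y} \<in> edges (iic_tree c))" for x y
    proof -
      have "{x, y} \<in> edges (iic_tree c) \<longleftrightarrow>
          x \<in> verts (iic_tree c) \<and> y \<in> verts (iic_tree c) \<and> (iic_par x y \<or> iic_par y x)" for c
      proof -
        have "x \<in> verts (iic_tree c) \<and> y \<in> verts (iic_tree c)" if "{x, y} \<in> edges (iic_tree c)"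
          using that unfolding iic_tree_def
          by (auto simp: doubleton_eq_iff edges_gw_tree snoc_gw_nodes)
        then show ?thesis using edges_iic by blast
      qed
      then show ?thesis using v by simp
    qed
    show "?A \<in> sets iic_measure"
      unfolding iic_rooted_def using v e H by (rule neighborhood_iso_measurable)
    show "c \<in> ?A \<longleftrightarrow> nbhd_event r H b x" if "c \<in> E x" for c x
      using that spine_rep_nbhd_event[OF iic_coded_spine_rep[of c "fst x" "snd x" r]]
      by (auto simp: E_def iic_rooted_def split: if_splits)
  qed (rule prob_space_iic)
qed

subsection \<open>The tree of the parent relation\<close>

text \<open>\<open>g\<close> is the identity or the reflection \<open>uminus\<close>; every result
  below uses only that it is an involution or commutes with shifts up to sign, so both trees are
  treated at once.\<close>

definition par_graph :: "(int \<Rightarrow> int) \<Rightarrow> (int \<Rightarrow> nat) \<Rightarrow> int graph" where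
  "par_graph g \<xi> = \<lparr>verts = UNIV, edges = {{g u, g w} | u w. par \<xi> u w}\<rparr>"

lemma verts_par_graph [simp]: "verts (par_graph g \<xi>) = UNIV"
  by (simp add: par_graph_def)

lemma edges_par_graph:
  assumes g: "\<And>x. g (g x) = x"
  shows "{a, b} \<in> edges (par_graph g \<xi>) \<longleftrightarrow> par \<xi> (g a) (g b) \<or> par \<xi> (g b) (g a)"
proof -
  have *: "a = g u \<longleftrightarrow> u = g a" for a u by (metis g)
  show ?thesis by (auto simp: par_graph_def doubleton_eq_iff *)
qed

lemma simple_par_graph:
  assumes g: "\<And>x. g (g x) = x"
  shows "simple_graph (par_graph g \<xi>)"
proof -
  have "g u \<noteq> g w" if "par \<xi> u w" for u w
    using that g par_less by (metis less_irrefl)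
  then show ?thesis by (auto simp: simple_graph_def par_graph_def)
qed

text \<open>Parent edges do not cross: \<open>rise \<xi> x v\<close> is negative and
  \<open>rise \<xi> x w\<close> is not, so the walk from \<open>v\<close> is positive at
  \<open>w\<close> and the parent of \<open>v\<close> is at most \<open>w\<close>. Repeat from
  there.\<close>

lemma par_below:
  assumes "par \<xi> x w" "x < v" "v \<le> w"
  shows "(par \<xi>)\<^sup>*\<^sup>* v w"
  using assms(2,3)
proof (induction "nat (w - v)" arbitrary: v rule: less_induct)
  case less
  show ?case
  proof (cases "v = w")
    case False
    with less.prems have vw: "v < w" by simp
    have "rise \<xi> x v < 0" "0 \<le> rise \<xi> x w"
      using assms(1) less.prems(1) vw by (auto simp: par_def)
    with rise_split[of x v w \<xi>] less.prems vw have "0 \<le> rise \<xi> v w" by simp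
    then obtain v' where v': "par \<xi> v v'" "v' \<le> w" using par_exists_le vw by blast
    then have "(par \<xi>)\<^sup>*\<^sup>* v' w"
      using less par_less[OF v'(1)] by auto
    with v'(1) show ?thesis by (rule converse_rtranclp_into_rtranclp)
  qed simp
qed

text \<open>Either the parent of \<open>u\<close> is at or beyond \<open>v\<close>, and then it is
  an ancestor of \<open>v\<close> by \<open>par_below\<close>, or it is closer to \<open>v\<close>
  than \<open>u\<close> was.\<close>

lemma par_common_ancestor:
  assumes ex: "\<And>v. \<exists>w. par \<xi> v w" and "u \<le> v"
  shows "\<exists>w. (par \<xi>)\<^sup>*\<^sup>* u w \<and> (par \<xi>)\<^sup>*\<^sup>* v w"
  using assms(2)
proof (induction "nat (v - u)" arbitrary: u rule: less_induct)
  case less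
  obtain u' where u': "par \<xi> u u'" using ex by blast
  consider "u = v" | "u < v" "v \<le> u'" | "u' < v" using less.prems by linarith
  then show ?case
  proof cases
    case 2
    then show ?thesis using u' par_below by blast
  next
    case 3
    with less par_less[OF u'] obtain w where "(par \<xi>)\<^sup>*\<^sup>* u' w" "(par \<xi>)\<^sup>*\<^sup>* v w" by fastforce
    with u' show ?thesis by (meson converse_rtranclp_into_rtranclp)
  qed auto
qed

lemma walk_of_rtranclp:
  assumes "(\<lambda>a b. {a, b} \<in> edges G)\<^sup>*\<^sup>* a b" "verts G = UNIV"
  shows "\<exists>xs. walk G xs \<and> hd xs = a \<and> last xs = b"
  using assms(1)
proof (induction rule: rtranclp_induct)
  case base
  show ?case using assms(2) by (intro exI[of _ "[a]"]) (simp add: walk_def)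
next
  case (step b c)
  then obtain xs where "walk G xs" "hd xs = a" "last xs = b" by blast
  with step.hyps(2) assms(2) show ?case
    by (intro exI[of _ "xs @ [c]"]) (auto simp: walk_def successively_append_iff)
qed

lemma connected_par_graph:
  assumes g: "\<And>x. g (g x) = x" and ex: "\<And>v. \<exists>w. par \<xi> v w"
  shows "is_connected (par_graph g \<xi>)"
proof -
  let ?R = "\<lambda>a b. {a, b} \<in> edges (par_graph g \<xi>)"
  have up: "?R\<^sup>*\<^sup>* (g u) (g w)" if "(par \<xi>)\<^sup>*\<^sup>* u w" for u w
    using that
  proof (induction rule: rtranclp_induct)
    case (step y z)
    then have "?R (g y) (g z)" by (simp add: edges_par_graph g)
    with step.IH show ?case by (rule rtranclp.rtrancl_into_rtrancl)
  qed simp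
  have sym: "?R\<^sup>*\<^sup>* a b" if "?R\<^sup>*\<^sup>* b a" for a b
  proof -
    have "symp ?R\<^sup>*\<^sup>*" by (intro symp_rtranclp) (auto simp: symp_def insert_commute)
    then show ?thesis using that by (rule sympD)
  qed
  have le: "?R\<^sup>*\<^sup>* (g u) (g v)" if uv: "u \<le> v" for u v
  proof -
    obtain w where w: "(par \<xi>)\<^sup>*\<^sup>* u w" "(par \<xi>)\<^sup>*\<^sup>* v w" using par_common_ancestor[OF ex uv] by blast
    show ?thesis using rtranclp_trans[OF up[OF w(1)] sym[OF up[OF w(2)]]] .
  qed
  have "?R\<^sup>*\<^sup>* a b" for a b
    using le[of "g a" "g b"] sym[OF le[of "g b" "g a"]] g by (cases "g a \<le> g b") auto
  then have "\<exists>xs. walk (par_graph g \<xi>) xs \<and> hd xs = a \<and> last xs = b" for a b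
    by (intro walk_of_rtranclp) simp_all
  then show ?thesis by (simp add: is_connected_def)
qed

text \<open>At the vertex of the cycle whose walk position is smallest, both cycle neighbours would
  have to be its parent.\<close>

lemma acyclic_par_graph:
  assumes g: "\<And>x. g (g x) = x"
  shows "\<not> is_cycle (par_graph g \<xi>) xs"
proof
  assume c: "is_cycle (par_graph g \<xi>) xs"
  then have d: "distinct xs" and n: "3 \<le> length xs" and w: "walk (par_graph g \<xi>) xs"
    and e: "{last xs, hd xs} \<in> edges (par_graph g \<xi>)"
    by (auto simp: is_cycle_def)
  define m where "m = Min (g ` set xs)"
  have "m \<in> g ` set xs" unfolding m_def using n by (intro Min_in) auto
  then obtain i where i: "i < length xs" "m = g (xs ! i)" by (auto simp: in_set_conv_nth)
  have up: "par \<xi> m (g (xs ! j))" if "j < length xs" "{xs ! i, xs ! j} \<in> edges (par_graph g \<xi>)" for j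
  proof -
    have "m \<le> g (xs ! j)" unfolding m_def using that(1) by (intro Min_le) auto
    then show ?thesis
      using that(2) i(2) par_less[of \<xi> "g (xs ! j)" m] by (auto simp: edges_par_graph g)
  qed
  have step: "{xs ! k, xs ! Suc k} \<in> edges (par_graph g \<xi>)" if "Suc k < length xs" for k
    using w that by (simp add: walk_nth)
  have wrap: "{xs ! (length xs - 1), xs ! 0} \<in> edges (par_graph g \<xi>)"
    using e n by (simp add: last_conv_nth hd_conv_nth flip: length_greater_0_conv)
  have "\<exists>j k. j < length xs \<and> k < length xs \<and> j \<noteq> k \<and>
      {xs ! i, xs ! j} \<in> edges (par_graph g \<xi>) \<and> {xs ! i, xs ! k} \<in> edges (par_graph g \<xi>)"
  proof -
    consider "i = 0" | "i = length xs - 1" | "0 < i" "Suc i < length xs" using i by linarith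
    then show ?thesis
    proof cases
      case 1
      with step[of 0] wrap n show ?thesis
        by (intro exI[of _ 1] exI[of _ "length xs - 1"]) (auto simp: insert_commute)
    next
      case 2
      with step[of "length xs - 2"] wrap n show ?thesis
        by (intro exI[of _ "length xs - 2"] exI[of _ 0]) (auto simp: insert_commute Suc_diff_Suc numeral_2_eq_2)
    next
      case 3
      with step[of "i - 1"] step[of i] show ?thesis
        by (intro exI[of _ "i - 1"] exI[of _ "Suc i"]) (auto simp: insert_commute)
    qed
  qed
  then obtain j k where jk: "j < length xs" "k < length xs" "j \<noteq> k"
    "par \<xi> m (g (xs ! j))" "par \<xi> m (g (xs ! k))" using up by blast
  then have "xs ! j = xs ! k" using par_unique g by metis
  with jk d show False by (simp add: nth_eq_iff_index_eq)
qed

lemma is_tree_par_graph: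
  assumes "\<And>x. g (g x) = x" "\<And>v. \<exists>w. par \<xi> v w"
  shows "is_tree (par_graph g \<xi>)"
  using assms simple_par_graph connected_par_graph acyclic_par_graph unfolding is_tree_def by metis

text \<open>An edge that increases the walk position leads to the unique parent, so the path is
  forced to iterate the parent map.\<close>

lemma unique_infinite_path:
  assumes g: "\<And>x. g (g x) = x" and ex: "\<And>v. \<exists>w. par \<xi> v w"
  shows "\<exists>!p. infinite_path_from (par_graph g \<xi>) v p \<and> rightward (g \<circ> p)"
proof -
  define next_up where "next_up u = (SOME w. par \<xi> u w)" for u
  have nx: "par \<xi> u (next_up u)" for u unfolding next_up_def using ex by (rule someI_ex)
  define p where "p k = g ((next_up ^^ k) (g v))" for k
  have edge: "{p k, p (Suc k)} \<in> edges (par_graph g \<xi>)" "g (p k) < g (p (Suc k))" for k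
    using nx[of "(next_up ^^ k) (g v)"] par_less by (simp_all add: p_def edges_par_graph g)
  have "strict_mono (g \<circ> p)" using edge(2) by (simp add: strict_mono_Suc_iff)
  then have "inj p" using strict_mono_imp_inj_on inj_on_imageI2 by metis
  then have "infinite_path_from (par_graph g \<xi>) v p \<and> rightward (g \<circ> p)"
    using edge by (simp add: infinite_path_from_def rightward_def p_def g)
  moreover have "q = p" if q: "infinite_path_from (par_graph g \<xi>) v q \<and> rightward (g \<circ> q)" for q
  proof
    fix k
    show "q k = p k"
    proof (induction k)
      case 0
      then show ?case using q by (simp add: infinite_path_from_def p_def g)
    next
      case (Suc k)
      have "{q k, q (Suc k)} \<in> edges (par_graph g \<xi>)" "g (q k) < g (q (Suc k))"
        using q by (simp_all add: infinite_path_from_def rightward_def)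
      then have "par \<xi> (g (q k)) (g (q (Suc k)))"
        using par_less by (force simp: edges_par_graph g)
      moreover have "par \<xi> (g (q k)) (g (p (Suc k)))"
        using edge[of k] par_less Suc.IH by (force simp: edges_par_graph g)
      ultimately show ?case using par_unique g by metis
    qed
  qed
  ultimately show ?thesis by blast
qed

text \<open>Just before a first passage the walk is at most 0, and at a leaf it steps down.\<close>

lemma no_par_into_leaf: "\<xi> v = 0 \<Longrightarrow> \<not> par \<xi> u v"
proof
  assume 0: "\<xi> v = 0" and p: "par \<xi> u v"
  then have "u < v" by (simp add: par_def)
  then have "rise \<xi> u (v - 1) \<le> 0"
    using p unfolding par_def by (cases "u = v - 1") (auto simp: less_imp_le)
  with rise_last[OF \<open>u < v\<close>, of \<xi>] p 0 show False by (simp add: par_def)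
qed

lemma matches_forest_leaf: "matches_forest \<xi> x f \<Longrightarrow> f \<noteq> Void \<Longrightarrow> \<exists>v. \<xi> v = 0"
proof (induction f arbitrary: x)
  case (Tree f g)
  then show ?case by (cases "f = Void") auto
qed simp

text \<open>At a leaf \<open>v\<close> of the first tree all edges go right, whereas in the
  reflected tree \<open>v\<close> has its parent on the left.\<close>

lemma par_graph_neq:
  assumes "\<xi> v = 0" "\<And>v. \<exists>w. par \<eta> v w"
  shows "par_graph id \<xi> \<noteq> par_graph uminus \<eta>"
proof
  assume eq: "par_graph id \<xi> = par_graph uminus \<eta>"
  obtain w where w: "par \<eta> (- v) w" using assms(2) by blast
  then have "{v, - w} \<in> edges (par_graph uminus \<eta>)" by (simp add: edges_par_graph)
  then have "par \<xi> v (- w) \<or> par \<xi> (- w) v" by (simp add: edges_par_graph flip: eq)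
  moreover have "- w < v" using par_less[OF w] by simp
  ultimately show False using no_par_into_leaf assms(1) par_less by fastforce
qed

subsection \<open>The local law of the tree\<close>

text \<open>The tree below an ancestor can be left only through the parent edge of its top, so
  enlarging the radius by one costs one further ancestor.\<close>

lemma ball_par_graph:
  assumes g: "\<And>x. g (g x) = x"
  shows "spine_match \<xi> v f0 xs \<Longrightarrow>
    ball_verts (length xs) (par_graph g \<xi>, g v) \<subseteq> g ` tree_block (spine_pos v xs) (spine_forest f0 xs)"
proof (induction xs)
  case Nil
  then show ?case
    using ball_verts_0[of "par_graph g \<xi>" "g v"] is_spine_top[OF spine_match_is_spine[OF Nil]] by auto
next
  case (Cons x xs)
  obtain f j where x: "x = (f, j)" by (cases x)
  define n' where "n' = spine_pos v xs"
  define n where "n = spine_pos v ((f, j) # xs)"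
  define S where "S = tree_block n' (spine_forest f0 xs)"
  define S' where "S' = tree_block n (spine_forest f0 ((f, j) # xs))"
  have sm: "spine_match \<xi> v f0 ((f, j) # xs)" using Cons.prems x by simp
  note st = spine_match_step[OF sm, folded n'_def n_def, folded S_def]
  have "block n (Tree h Void) = insert n (block (n - 1) h)" for h
    unfolding block_Tree by auto
  then have "S' = insert n (block (n - 1) (insert_tree j f (spine_forest f0 xs)))"
    by (simp only: S'_def spine_forest.simps)
  with st(4) have S: "insert n S \<subseteq> S'" by blast
  have nb: "w \<in> insert n S" if "u \<in> S" "par \<xi> u w \<or> par \<xi> w u" for u w
    using that spine_match_par_into[OF st(1)] spine_match_par_from[OF st(1)] st(2) par_unique
    unfolding S_def n'_def by blast
  have "ball_verts (length xs) (par_graph g \<xi>, g v) \<subseteq> g ` S"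
    using Cons.IH[OF st(1)] by (simp only: S_def n'_def)
  moreover have "w \<in> g ` S'" if u: "u \<in> g ` S" and uw: "{u, w} \<in> edges (par_graph g \<xi>)" for u w
  proof -
    obtain u' where "u = g u'" "u' \<in> S" using u by (elim imageE) simp
    then have "g w \<in> insert n S" using uw by (intro nb[of u']) (auto simp: edges_par_graph g)
    with S have "g w \<in> S'" by blast
    then show ?thesis using g by (metis imageI)
  qed
  ultimately have "ball_verts (Suc (length xs)) (par_graph g \<xi>, g v) \<subseteq> g ` S'"
    using ball_verts_Suc[of "length xs" "par_graph g \<xi>" "g v"] S by blast
  then show ?case unfolding x by (simp only: S'_def n_def length_Cons)
qed

lemma spine_match_spine_rep:
  assumes g: "\<And>x. g (g x) = x" and sm: "spine_match \<xi> v f0 xs"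
  shows "spine_rep (par \<xi>) (tree_block (spine_pos v xs) (spine_forest f0 xs)) g (length xs)
    (par_graph g \<xi>) (g v) f0 (map fst xs)"
proof -
  have "inj_on g A" for A using g by (metis inj_onI)
  moreover have "{g x, g y} \<in> edges (par_graph g \<xi>) \<longleftrightarrow> par \<xi> x y \<or> par \<xi> y x" for x y
    by (simp add: edges_par_graph g)
  ultimately show ?thesis
    using spine_match_is_spine[OF sm] ball_par_graph[OF g sm] unfolding spine_rep_def
    by (simp only: verts_par_graph subset_UNIV) blast
qed

section \<open>Probabilities of marked spines and the resulting local law\<close>

fun match_labels :: "int \<Rightarrow> forest \<Rightarrow> (int \<times> nat) list" where
  "match_labels x Void = []"
| "match_labels x (Tree f g) =
     (x, width f) # match_labels (x - 1) f @ match_labels (x - 1 - extent f) g"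

lemma matches_forest_iff_labels: "matches_forest \<xi> x f \<longleftrightarrow> (\<forall>(y, n)\<in>set (match_labels x f). \<xi> y = n)"
  by (induction f arbitrary: x) (simp_all add: ball_Un)

lemma match_labels_block: "fst ` set (match_labels x f) \<subseteq> block x f"
proof (induction f arbitrary: x)
  case (Tree f g)
  show ?case
    using Tree.IH(1)[of "x - 1"] Tree.IH(2)[of "x - 1 - extent f"]
    unfolding block_Tree by auto
qed simp

lemma match_labels_distinct: "distinct (map fst (match_labels x f))"
proof (induction f arbitrary: x)
  case (Tree f g)
  let ?L = "match_labels (x - 1) f" and ?L' = "match_labels (x - 1 - extent f) g"
  have "x \<notin> block (x - 1) f" "x \<notin> block (x - 1 - extent f) g"
    "block (x - 1) f \<inter> block (x - 1 - extent f) g = {}"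
    using extent_nonneg[of f] by auto
  moreover note match_labels_block[of "x - 1" f] match_labels_block[of "x - 1 - extent f" g]
  ultimately have "x \<notin> fst ` set ?L" "x \<notin> fst ` set ?L'" "fst ` set ?L \<inter> fst ` set ?L' = {}"
    by (meson subsetD, meson subsetD, metis Int_mono subset_empty)
  then show ?case using Tree.IH by simp
qed simp

lemma match_labels_weight: "prod_list (map (pois \<circ> snd) (match_labels x f)) = forest_weight f"
  by (induction f arbitrary: x) auto

lemma matches_tree_prob:
  assumes "pois_family M X"
  shows "{\<omega> \<in> space M. matches_tree (\<lambda>i. X i \<omega>) v f} \<in> sets M"
    and "measure M {\<omega> \<in> space M. matches_tree (\<lambda>i. X i \<omega>) v f} = tree_weight f"
proof -
  note L = pois_family_labels[OF assms match_labels_distinct[of v "Tree f Void"]]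
  show "{\<omega> \<in> space M. matches_tree (\<lambda>i. X i \<omega>) v f} \<in> sets M"
    using L(1) unfolding matches_tree_def matches_forest_iff_labels .
  show "measure M {\<omega> \<in> space M. matches_tree (\<lambda>i. X i \<omega>) v f} = tree_weight f"
    using L(2) match_labels_weight[of v "Tree f Void"]
    unfolding matches_tree_def matches_forest_iff_labels forest_weight_Tree by simp
qed

lemma forest_weight_insert_tree: "j \<le> width f \<Longrightarrow> forest_weight (insert_tree j f y) = tree_weight y * forest_weight f"
  by (induction j f y rule: insert_tree.induct) (auto simp: forest_weight_Tree simp del: forest_weight.simps(2))

text \<open>This is \<open>pois (Suc k) = pois k / Suc k\<close>: the size-biased Poisson(1) law is
  one plus a Poisson(1) variable, and the divisor is absorbed by the uniform position of the spine
  child.\<close>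

lemma tree_weight_insert_tree: "j \<le> width f \<Longrightarrow> tree_weight (insert_tree j f y) = tree_weight f / Suc (width f) * tree_weight y"
  by (simp add: tree_weight_def[of "insert_tree j f y"] tree_weight_def[of f] forest_weight_insert_tree width_insert_tree field_simps)

lemma tree_weight_spine_forest:
  "\<forall>(f, j)\<in>set xs. j \<le> width f \<Longrightarrow>
    tree_weight (spine_forest f0 xs) = tree_weight f0 * prod_list (map (pmf marked_pmf) xs)"
  by (induction f0 xs rule: spine_forest.induct) (auto simp: tree_weight_insert_tree pmf_marked_pmf)

definition marked_spine_pmf :: "nat \<Rightarrow> (forest \<times> (forest \<times> nat) list) pmf" where
  "marked_spine_pmf r = pair_pmf gw_pmf (replicate_pmf r marked_pmf)"

lemma map_marked_spine_pmf: "map_pmf (\<lambda>(f0, xs). (f0, map fst xs)) (marked_spine_pmf r) = spine_pmf r"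
  using map_pair[of id "map fst" gw_pmf "replicate_pmf r marked_pmf"]
  by (simp add: marked_spine_pmf_def spine_pmf_def map_replicate_pmf map_fst_marked_pmf pmf.map_id id_def)

definition spine_event ::
    "'a measure \<Rightarrow> (int \<Rightarrow> 'a \<Rightarrow> nat) \<Rightarrow> int \<Rightarrow> nat \<Rightarrow> forest \<times> (forest \<times> nat) list \<Rightarrow> 'a set" where
  "spine_event M X v r x =
     {\<omega> \<in> space M. length (snd x) = r \<and> spine_match (\<lambda>i. X i \<omega>) v (fst x) (snd x)}"

lemma spine_event:
  assumes "pois_family M X"
  shows "spine_event M X v r x \<in> sets M"
    and "measure M (spine_event M X v r x) = pmf (marked_spine_pmf r) x"
    and "\<omega> \<in> spine_event M X v r x \<Longrightarrow> \<omega> \<in> spine_event M X v r y \<Longrightarrow> x = y"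
proof -
  obtain f0 xs where x: "x = (f0, xs)" by (cases x)
  let ?ok = "length xs = r \<and> (\<forall>(f, j)\<in>set xs. j \<le> width f)"
  have eq: "spine_event M X v r x = (if ?ok then
      {\<omega> \<in> space M. matches_tree (\<lambda>i. X i \<omega>) (spine_pos v xs) (spine_forest f0 xs)} else {})"
    unfolding spine_event_def spine_match_def x by auto
  show "spine_event M X v r x \<in> sets M"
    unfolding eq using matches_tree_prob(1)[OF assms] by simp
  \<comment> \<open>A mark beyond \<open>width f\<close> has zero mass in \<open>marked_pmf\<close>,
    which matches the empty event.\<close>
  have 0: "prod_list (map (pmf marked_pmf) xs) = 0" if "\<not> (\<forall>(f, j)\<in>set xs. j \<le> width f)"
    using that by (force simp: prod_list_zero_iff pmf_marked_pmf)
  show "measure M (spine_event M X v r x) = pmf (marked_spine_pmf r) x"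
    unfolding eq using matches_tree_prob(2)[OF assms] 0
    by (auto simp: x marked_spine_pmf_def pmf_pair pmf_gw_pmf pmf_replicate tree_weight_spine_forest)
  show "x = y" if "\<omega> \<in> spine_event M X v r x" "\<omega> \<in> spine_event M X v r y"
    using that spine_match_unique[of "\<lambda>i. X i \<omega>" v "fst x" "snd x" "fst y" "snd y"]
    by (auto simp: spine_event_def prod_eq_iff)
qed

text \<open>For each length \<open>r\<close> the spine events cover the space almost surely. Length
  1 exhibits a parent of \<open>v\<close>; length 0 makes the tree below 0 finite, and a finite tree
  has a leaf.\<close>

lemma AE_par_exists:
  assumes "prob_space M" "pois_family M X"
  shows "AE \<omega> in M. \<forall>v. \<exists>w. par (\<lambda>i. X i \<omega>) v w"
    and "AE \<omega> in M. \<exists>v. X v \<omega> = 0"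
proof -
  have E: "AE \<omega> in M. \<exists>x. \<omega> \<in> spine_event M X v r x" for v r
    by (rule measure_by_pmf(1)[OF assms(1) spine_event(1,2)[OF assms(2)]])
      (rule spine_event(3)[OF assms(2)])
  have "AE \<omega> in M. \<exists>w. par (\<lambda>i. X i \<omega>) v w" for v
    using E[of v 1]
  proof (rule AE_mp, intro AE_I2 impI)
    fix \<omega> assume "\<exists>x. \<omega> \<in> spine_event M X v 1 x"
    then obtain f0 xs where xs: "length xs = 1" "spine_match (\<lambda>i. X i \<omega>) v f0 xs"
      by (auto simp: spine_event_def)
    then obtain f j where "xs = [(f, j)]" by (auto simp: length_Suc_conv)
    with spine_match_step(2)[of "\<lambda>i. X i \<omega>" v f0 f j "[]"] xs(2)
    show "\<exists>w. par (\<lambda>i. X i \<omega>) v w" by auto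
  qed
  then show "AE \<omega> in M. \<forall>v. \<exists>w. par (\<lambda>i. X i \<omega>) v w"
    by (simp add: AE_all_countable)
  show "AE \<omega> in M. \<exists>v. X v \<omega> = 0"
    using E[of 0 0]
  proof (rule AE_mp, intro AE_I2 impI)
    fix \<omega> assume "\<exists>x. \<omega> \<in> spine_event M X 0 0 x"
    then obtain f0 where "matches_tree (\<lambda>i. X i \<omega>) 0 f0"
      by (auto simp: spine_event_def spine_match_def)
    then show "\<exists>v. X v \<omega> = 0"
      using matches_forest_leaf[of "\<lambda>i. X i \<omega>" 0 "Tree f0 Void"] unfolding matches_tree_def by blast
  qed
qed

lemma measurable_sum_int:
  fixes f :: "'i \<Rightarrow> 'a \<Rightarrow> int"
  assumes "finite A" and f: "\<And>i. i \<in> A \<Longrightarrow> f i \<in> M \<rightarrow>\<^sub>M count_space UNIV"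
  shows "(\<lambda>\<omega>. \<Sum>i\<in>A. f i \<omega>) \<in> M \<rightarrow>\<^sub>M count_space UNIV"
  using assms
proof (induction A rule: finite_induct)
  case (insert i A)
  then have [measurable]: "(\<lambda>\<omega>. \<Sum>i\<in>A. f i \<omega>) \<in> M \<rightarrow>\<^sub>M count_space UNIV" by simp
  have "(\<lambda>\<omega>. f i \<omega> + (\<Sum>i\<in>A. f i \<omega>)) \<in> M \<rightarrow>\<^sub>M count_space UNIV"
    by (rule measurable_compose_countable[of "\<lambda>k \<omega>. k + (\<Sum>i\<in>A. f i \<omega>)"]) (use insert in auto)
  with insert.hyps show ?case by simp
qed simp

lemma par_measurable:
  assumes [measurable]: "\<And>i. X i \<in> M \<rightarrow>\<^sub>M count_space UNIV"
  shows "Measurable.pred M (\<lambda>\<omega>. par (\<lambda>i. X i \<omega>) u w)"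
proof -
  have [measurable]: "(\<lambda>\<omega>. rise (\<lambda>i. X i \<omega>) u w) \<in> M \<rightarrow>\<^sub>M count_space UNIV" for u w
    unfolding rise_def by (intro measurable_sum_int) simp_all
  show ?thesis unfolding par_def by measurable
qed

text \<open>Both laws are read off on shapes: forgetting the positions of the spine children maps
  \<open>marked_spine_pmf\<close> to \<open>spine_pmf\<close>. The root \<open>n\<close> of the
  graph is the walk position \<open>g n\<close>.\<close>

lemma par_graph_local_law:
  assumes M: "prob_space M" "pois_family M X" "\<And>i. X i \<in> M \<rightarrow>\<^sub>M count_space UNIV"
    and g: "\<And>x. g (g x) = x"
  shows "same_local_law M (\<lambda>\<omega>. (par_graph g (\<lambda>i. X i \<omega>), n)) iic_measure iic_rooted"
  unfolding same_local_law_def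
proof (intro allI impI)
  fix r and H :: "nat graph" and b
  assume H: "finite (verts H)"
  let ?A = "{\<omega> \<in> space M. rooted_iso (neighborhood r (par_graph g (\<lambda>i. X i \<omega>), n)) (H, b)}"
  have "Measurable.pred M (\<lambda>\<omega>. {u, v} \<in> edges (par_graph g (\<lambda>i. X i \<omega>)))" for u v
    unfolding edges_par_graph[OF g] using par_measurable[OF M(3)] by measurable
  then have A: "?A \<in> sets M"
    by (intro neighborhood_iso_measurable H) auto
  have "measure M ?A = measure_pmf.prob (marked_spine_pmf r)
      {x. nbhd_event r H b ((\<lambda>(f0, xs). (f0, map fst xs)) x)}"
  proof (rule measure_by_pmf(2)[OF M(1), of "spine_event M X (g n) r"])
    show "x = y" if "\<omega> \<in> spine_event M X (g n) r x" "\<omega> \<in> spine_event M X (g n) r y" for x y \<omega>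
      using spine_event(3)[OF M(2)] that .
    show "\<omega> \<in> ?A \<longleftrightarrow> nbhd_event r H b ((\<lambda>(f0, xs). (f0, map fst xs)) x)"
      if "\<omega> \<in> spine_event M X (g n) r x" for x \<omega>
    proof -
      have sm: "spine_match (\<lambda>i. X i \<omega>) (g n) (fst x) (snd x)" "length (snd x) = r" "\<omega> \<in> space M"
        using that by (auto simp: spine_event_def)
      show ?thesis
        using spine_rep_nbhd_event[OF spine_match_spine_rep[OF g sm(1)]] sm(2,3)
        by (simp add: g case_prod_beta)
    qed
  qed (use A spine_event(1,2)[OF M(2)] in simp_all)
  also have "\<dots> = measure_pmf.prob (spine_pmf r) {x. nbhd_event r H b x}"
    by (simp add: vimage_def flip: map_marked_spine_pmf)
  also have "\<dots> = measure iic_measure {c \<in> space iic_measure. rooted_iso (neighborhood r (iic_rooted c)) (H, b)}"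
    by (rule iic_nbhd_law[OF H, symmetric])
  finally show "measure M ?A =
      measure iic_measure {c \<in> space iic_measure. rooted_iso (neighborhood r (iic_rooted c)) (H, b)}" .
qed

subsection \<open>Counts of a Poisson process in unit boxes\<close>

text \<open>Area one makes the offspring mean critical; half-open sides make the boxes disjoint and
  hence their counts independent.\<close>

definition unit_box :: "bool \<times> int \<Rightarrow> (real \<times> real) set" where
  "unit_box = (\<lambda>(b, v). {of_int v..<of_int v + 1} \<times> {of_bool b..<of_bool b + 1})"

definition box_count :: "(real \<times> real) set \<Rightarrow> bool \<times> int \<Rightarrow> nat" where
  "box_count C x = card (C \<inter> unit_box x)"

lemma unit_box_borel: "unit_box x \<in> sets borel"
  unfolding unit_box_def borel_prod[symmetric] by (auto split: prod.split)

lemma unit_box_bounded: "bounded (unit_box x)"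
proof -
  have "bounded {a..<b}" for a b :: real
    by (rule bounded_subset[OF bounded_closed_interval[of a b]]) auto
  then show ?thesis unfolding unit_box_def by (auto split: prod.split intro: bounded_Times)
qed

lemma unit_box_half_plane: "unit_box x \<subseteq> half_plane"
  by (auto simp: unit_box_def half_plane_def split: prod.splits)

lemma measure_unit_box: "measure lborel (unit_box x) = 1"
proof -
  have "emeasure (lborel \<Otimes>\<^sub>M lborel) ({a..<a + 1} \<times> {b..<b + 1}) = 1" for a b :: real
    by (subst lborel.emeasure_pair_measure_Times) auto
  then show ?thesis
    by (auto simp: measure_def unit_box_def lborel_prod split: prod.split)
qed

lemma unit_box_disjoint: "x \<noteq> y \<Longrightarrow> unit_box x \<inter> unit_box y = {}"
proof (rule ccontr)
  assume "unit_box x \<inter> unit_box y \<noteq> {}"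
  then obtain a b where ab: "(a, b) \<in> unit_box x" "(a, b) \<in> unit_box y" by auto
  obtain p i where x: "x = (p, i)" by (cases x)
  obtain q j where y: "y = (q, j)" by (cases y)
  note xy = x y
  have "i = j" using ab unfolding xy unit_box_def by simp
  moreover have "p = q" using ab unfolding xy unit_box_def by (cases p; cases q) auto
  moreover assume "x \<noteq> y"
  ultimately show False using xy by simp
qed

lemma measurable_box_count:
  "(\<lambda>C. box_count C x) \<in> config_space half_plane \<rightarrow>\<^sub>M count_space UNIV"
proof -
  let ?G = "{{C \<in> configurations half_plane. card (C \<inter> B) = k} | B k. B \<in> sets borel \<and> bounded B}"
  have G: "?G \<subseteq> Pow (configurations half_plane)" by auto
  have "(\<lambda>C. box_count C x) -` {k} \<inter> space (config_space half_plane) \<in> sets (config_space half_plane)" for k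
  proof -
    have "(\<lambda>C. box_count C x) -` {k} \<inter> configurations half_plane =
        {C \<in> configurations half_plane. card (C \<inter> unit_box x) = k}"
      by (auto simp: box_count_def)
    also have "\<dots> \<in> ?G" using unit_box_borel unit_box_bounded by blast
    finally show ?thesis
      unfolding config_space_def space_measure_of[OF G] sets_measure_of[OF G] by (rule sigma_sets.Basic)
  qed
  then show ?thesis by (simp add: measurable_count_space_eq2_countable)
qed

text \<open>Independence of an infinite family concerns finite subfamilies only. These are renamed
  by \<open>to_nat\<close>, since the process provides independence for families indexed by natural
  numbers.\<close>

lemma indep_box_counts:
  assumes M: "prob_space M" and P: "poisson_process M 1 half_plane \<P>"
  shows "prob_space.indep_vars M (\<lambda>_. count_space UNIV) (\<lambda>x \<omega>. box_count (\<P> \<omega>) x) UNIV"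
proof -
  interpret prob_space M by (rule M)
  have rv: "random_variable (count_space UNIV) (\<lambda>\<omega>. box_count (\<P> \<omega>) x)" for x
  proof (rule measurable_compose[OF _ measurable_box_count])
    show "\<P> \<in> M \<rightarrow>\<^sub>M config_space half_plane" using P by (simp add: poisson_process_def)
  qed
  define F where "F x = sigma_sets (space M)
    {(\<lambda>\<omega>. box_count (\<P> \<omega>) x) -` A \<inter> space M |A. A \<in> sets (count_space UNIV)}" for x
  have "indep_sets F UNIV"
    unfolding indep_sets_def
  proof (intro conjI ballI allI impI)
    show "F x \<subseteq> events" for x
      unfolding F_def by (intro sets.sigma_sets_subset) (use measurable_sets[OF rv] in blast)
    fix J and A :: "bool \<times> int \<Rightarrow> 'a set"
    assume J: "J \<subseteq> UNIV" "J \<noteq> {}" "finite J" and A: "A \<in> Pi J F"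
    let ?I = "to_nat ` J"
    have "indep_vars (\<lambda>_. count_space UNIV) (\<lambda>k \<omega>. card (\<P> \<omega> \<inter> unit_box (from_nat k))) ?I"
    proof -
      have "disjoint_family_on (\<lambda>k. unit_box (from_nat k)) ?I"
        unfolding disjoint_family_on_def using unit_box_disjoint by auto
      moreover have "\<forall>(I :: nat set) B. finite I \<longrightarrow>
          (\<forall>i\<in>I. B i \<in> sets borel \<and> bounded (B i) \<and> B i \<subseteq> half_plane) \<longrightarrow>
          disjoint_family_on B I \<longrightarrow>
          indep_vars (\<lambda>_. count_space UNIV) (\<lambda>i \<omega>. card (\<P> \<omega> \<inter> B i)) I"
        using P unfolding poisson_process_def by (elim conjE)
      ultimately show ?thesis
        using J(3) unit_box_borel unit_box_bounded unit_box_half_plane by simp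
    qed
    then have "indep_sets (\<lambda>k. F (from_nat k)) ?I"
      unfolding indep_vars_def F_def box_count_def by blast
    then have "prob (\<Inter>k\<in>?I. A (from_nat k)) = (\<Prod>k\<in>?I. prob (A (from_nat k)))"
      by (rule indep_setsD) (use J A in auto)
    then show "prob (\<Inter>j\<in>J. A j) = (\<Prod>j\<in>J. prob (A j))"
      by (simp add: prod.reindex)
  qed
  then show ?thesis unfolding indep_vars_def F_def using rv by blast
qed

lemma pois_family_box_counts:
  assumes M: "prob_space M" and P: "poisson_process M 1 half_plane \<P>" and h: "inj h"
  shows "pois_family M (\<lambda>i \<omega>. box_count (\<P> \<omega>) (h i))"
  unfolding pois_family_def
proof (intro allI impI)
  fix J :: "'b set" and a :: "'b \<Rightarrow> nat"
  assume J: "finite J"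
  interpret prob_space M by (rule M)
  let ?X = "\<lambda>x \<omega>. box_count (\<P> \<omega>) x"
  note ind = indep_box_counts[OF M P]
  have [measurable]: "?X x \<in> M \<rightarrow>\<^sub>M count_space UNIV" for x
    using ind unfolding indep_vars_def by blast
  have single: "prob (?X x -` {k} \<inter> space M) = pois k" for x k
  proof -
    have "?X x -` {k} \<inter> space M = {\<omega> \<in> space M. card (\<P> \<omega> \<inter> unit_box x) = k}"
      by (auto simp: box_count_def)
    moreover have "prob \<dots> = exp (- (1 * measure lborel (unit_box x))) *
        (1 * measure lborel (unit_box x)) ^ k / fact k"
    proof -
      have "\<forall>B k. B \<in> sets borel \<longrightarrow> bounded B \<longrightarrow> B \<subseteq> half_plane \<longrightarrow>
          prob {\<omega> \<in> space M. card (\<P> \<omega> \<inter> B) = k} =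
          exp (- (1 * measure lborel B)) * (1 * measure lborel B) ^ k / fact k"
        using P unfolding poisson_process_def by (elim conjE)
      then show ?thesis
        using unit_box_borel[of x] unit_box_bounded[of x] unit_box_half_plane[of x] by simp
    qed
    ultimately show ?thesis by (simp add: measure_unit_box)
  qed
  have "prob {\<omega> \<in> space M. \<forall>y\<in>J. ?X (h y) \<omega> = a y} = (\<Prod>y\<in>J. pois (a y))"
  proof (cases "J = {}")
    case True
    then show ?thesis by (simp add: prob_space)
  next
    case False
    have "{\<omega> \<in> space M. \<forall>y\<in>J. ?X (h y) \<omega> = a y} = (\<Inter>x\<in>h ` J. ?X x -` {a (inv h x)} \<inter> space M)"
      using False h by auto
    also have "prob \<dots> = (\<Prod>x\<in>h ` J. prob (?X x -` {a (inv h x)} \<inter> space M))"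
      using J False by (intro indep_varsD[OF ind]) auto
    also have "\<dots> = (\<Prod>y\<in>J. pois (a y))"
      unfolding single using h by (subst prod.reindex) (auto intro: inj_on_subset)
    finally show ?thesis .
  qed
  moreover have "{\<omega> \<in> space M. \<forall>y\<in>J. ?X (h y) \<omega> = a y} \<in> events"
    using J by measurable
  ultimately show "{\<omega> \<in> space M. \<forall>y\<in>J. ?X (h y) \<omega> = a y} \<in> events \<and>
      prob {\<omega> \<in> space M. \<forall>y\<in>J. ?X (h y) \<omega> = a y} = (\<Prod>y\<in>J. pois (a y))" by simp
qed

subsection \<open>Measurability, equivariance and independence\<close>

lemma edge_event_int_graph_space:
  "{G \<in> int_graphs. {i, j} \<in> edges G} \<in> sets int_graph_space"
  unfolding int_graph_space_def by (subst sets_measure_of) (auto intro!: sigma_sets.Basic)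

lemma measurable_par_graph:
  assumes X: "\<And>i. X i \<in> M \<rightarrow>\<^sub>M count_space UNIV" and g: "\<And>x. g (g x) = x"
  shows "(\<lambda>\<omega>. par_graph g (\<lambda>i. X i \<omega>)) \<in> M \<rightarrow>\<^sub>M int_graph_space"
  unfolding int_graph_space_def
proof (rule measurable_measure_of)
  have in_graphs: "par_graph g (\<lambda>i. X i \<omega>) \<in> int_graphs" for \<omega>
    using simple_par_graph[OF g] by (simp add: int_graphs_def)
  then show "(\<lambda>\<omega>. par_graph g (\<lambda>i. X i \<omega>)) \<in> space M \<rightarrow> int_graphs" by simp
  fix B assume "B \<in> {{G \<in> int_graphs. {i, j} \<in> edges G} |i j. True}"
  then obtain i j where B: "B = {G \<in> int_graphs. {i, j} \<in> edges G}" by blast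
  have eq: "(\<lambda>\<omega>. par_graph g (\<lambda>i. X i \<omega>)) -` B \<inter> space M =
      {\<omega> \<in> space M. par (\<lambda>i. X i \<omega>) (g i) (g j) \<or> par (\<lambda>i. X i \<omega>) (g j) (g i)}"
    using in_graphs by (auto simp: B edges_par_graph[OF g])
  have [measurable]: "Measurable.pred M (\<lambda>\<omega>. par (\<lambda>i. X i \<omega>) u w)" for u w
    by (rule par_measurable[OF X])
  show "(\<lambda>\<omega>. par_graph g (\<lambda>i. X i \<omega>)) -` B \<inter> space M \<in> sets M"
    unfolding eq by measurable
qed auto

lemma par_shift: "par (\<lambda>i. \<xi> (i - s)) u w \<longleftrightarrow> par \<xi> (u - s) (w - s)"
proof -
  have r: "rise (\<lambda>i. \<xi> (i - s)) u w = rise \<xi> (u - s) (w - s)" for u w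
    unfolding rise_def by (rule sum.reindex_bij_witness[of _ "\<lambda>i. i + s" "\<lambda>i. i - s"]) auto
  have "(\<forall>x. u < x \<and> x < w \<longrightarrow> rise \<xi> (u - s) (x - s) < 0) \<longleftrightarrow>
      (\<forall>x. u - s < x \<and> x < w - s \<longrightarrow> rise \<xi> (u - s) x < 0)"
  proof (intro iffI allI impI)
    fix x assume "\<forall>x. u < x \<and> x < w \<longrightarrow> rise \<xi> (u - s) (x - s) < 0" "u - s < x \<and> x < w - s"
    then show "rise \<xi> (u - s) x < 0" by (auto dest: spec[of _ "x + s"])
  qed simp
  then show ?thesis unfolding par_def r by simp
qed

text \<open>\<open>s\<close> shifts walk positions and \<open>n\<close> shifts labels: equal for
  \<open>id\<close>, of opposite sign for \<open>uminus\<close>.\<close>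

lemma par_graph_shift:
  assumes "\<And>x. g (x + s) = g x + n"
  shows "par_graph g (\<lambda>i. \<xi> (i - s)) = shift_graph n (par_graph g \<xi>)"
proof -
  have "(\<exists>u w. e = {g u, g w} \<and> par \<xi> (u - s) (w - s)) \<longleftrightarrow>
      (\<exists>u w. e = {g u + n, g w + n} \<and> par \<xi> u w)" for e
  proof
    assume "\<exists>u w. e = {g u, g w} \<and> par \<xi> (u - s) (w - s)"
    then obtain u w where "e = {g u, g w}" "par \<xi> (u - s) (w - s)" by blast
    moreover have "g u = g (u - s) + n" "g w = g (w - s) + n"
      using assms[of "u - s"] assms[of "w - s"] by simp_all
    ultimately show "\<exists>u w. e = {g u + n, g w + n} \<and> par \<xi> u w" by metis
  next
    assume "\<exists>u w. e = {g u + n, g w + n} \<and> par \<xi> u w"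
    then obtain u w where "e = {g (u + s), g (w + s)}" "par \<xi> u w" using assms by auto
    then show "\<exists>u w. e = {g u, g w} \<and> par \<xi> (u - s) (w - s)"
      by (intro exI[of _ "u + s"] exI[of _ "w + s"]) simp
  qed
  then have "{{g u, g w} |u w. par \<xi> (u - s) (w - s)} = {{g u + n, g w + n} |u w. par \<xi> u w}"
    by simp
  also have "\<dots> = (\<lambda>e. (\<lambda>i. i + n) ` e) ` {{g u, g w} |u w. par \<xi> u w}"
  proof -
    have "{g u + n, g w + n} = (\<lambda>i. i + n) ` {g u, g w}" for u w by simp
    then show ?thesis by blast
  qed
  finally have "{{g u, g w} |u w. par \<xi> (u - s) (w - s)} =
    (\<lambda>e. (\<lambda>i. i + n) ` e) ` {{g u, g w} |u w. par \<xi> u w}" .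
  moreover have "(\<lambda>i. i + n) ` UNIV = (UNIV :: int set)" by simp
  ultimately show ?thesis by (simp add: par_graph_def shift_graph_def par_shift)
qed

lemma box_count_shift: "box_count (shift_points n C) (b, v) = box_count C (b, v - n)"
proof -
  let ?s = "\<lambda>(x, y). (x + of_int n, y) :: real \<times> real"
  have "shift_points n C \<inter> unit_box (b, v) = ?s ` (C \<inter> unit_box (b, v - n))"
    unfolding shift_points_def unit_box_def by (force simp: image_iff)
  moreover have "inj ?s" by (auto simp: inj_def)
  ultimately show ?thesis
    unfolding box_count_def by (simp add: card_image inj_on_subset)
qed

text \<open>If \<open>U = f V\<close> almost surely, the event \<open>U \<in> B\<close> is almost
  surely determined by \<open>V\<close>. It is then independent of itself and has probability 0 or
  1.\<close>

lemma not_factor_of_indep: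
  assumes M: "prob_space M" and ind: "prob_space.indep_var M S U R V"
    and B: "B \<in> sets S" and q: "measure M (U -` B \<inter> space M) \<notin> {0, 1}"
  shows "\<not> is_factor_of M S U R V"
proof
  interpret prob_space M by (rule M)
  assume "is_factor_of M S U R V"
  then obtain f where f: "f \<in> R \<rightarrow>\<^sub>M S" "AE \<omega> in M. U \<omega> = f (V \<omega>)"
    unfolding is_factor_of_def by blast
  have rv: "U \<in> M \<rightarrow>\<^sub>M S" "V \<in> M \<rightarrow>\<^sub>M R"
    using indep_var_rv1[OF ind] indep_var_rv2[OF ind] by simp_all
  let ?B = "f -` B \<inter> space R"
  have "?B \<in> sets R" using f(1) B by (rule measurable_sets)
  have eq: "prob (V -` ?B \<inter> space M) = prob (U -` B \<inter> space M)"
    "prob ((\<lambda>\<omega>. (U \<omega>, V \<omega>)) -` (B \<times> ?B) \<inter> space M) = prob (U -` B \<inter> space M)"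
  proof -
    have V: "V \<omega> \<in> space R" if "\<omega> \<in> space M" for \<omega> using rv(2) that by (rule measurable_space)
    have m: "U -` B \<inter> space M \<in> events" "V -` ?B \<inter> space M \<in> events"
      by (rule measurable_sets[OF rv(1) B], rule measurable_sets[OF rv(2) \<open>?B \<in> sets R\<close>])
    have "(\<lambda>\<omega>. (U \<omega>, V \<omega>)) -` (B \<times> ?B) \<inter> space M = (U -` B \<inter> space M) \<inter> (V -` ?B \<inter> space M)"
      by auto
    with m have m2: "(\<lambda>\<omega>. (U \<omega>, V \<omega>)) -` (B \<times> ?B) \<inter> space M \<in> events" by simp
    show "prob (V -` ?B \<inter> space M) = prob (U -` B \<inter> space M)"
    proof (intro measure_eq_AE m)
      show "AE \<omega> in M. \<omega> \<in> V -` ?B \<inter> space M \<longleftrightarrow> \<omega> \<in> U -` B \<inter> space M"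
        using f(2) by eventually_elim (auto simp: V)
    qed
    show "prob ((\<lambda>\<omega>. (U \<omega>, V \<omega>)) -` (B \<times> ?B) \<inter> space M) = prob (U -` B \<inter> space M)"
    proof (intro measure_eq_AE m m2)
      show "AE \<omega> in M. \<omega> \<in> (\<lambda>\<omega>. (U \<omega>, V \<omega>)) -` (B \<times> ?B) \<inter> space M \<longleftrightarrow> \<omega> \<in> U -` B \<inter> space M"
        using f(2) by eventually_elim (auto simp: V)
    qed
  qed
  have "prob (U -` B \<inter> space M) = prob (U -` B \<inter> space M) * prob (U -` B \<inter> space M)"
    using indep_varD[OF ind B \<open>?B \<in> sets R\<close>] eq by simp
  with q show False by simp
qed

definition right_tree :: "(real \<times> real) set \<Rightarrow> int graph" where
  "right_tree C = par_graph id (\<lambda>i. box_count C (False, i))"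

definition left_tree :: "(real \<times> real) set \<Rightarrow> int graph" where
  "left_tree C = par_graph uminus (\<lambda>i. box_count C (True, - i))"

lemma right_tree_shift: "right_tree (shift_points n C) = shift_graph n (right_tree C)"
  unfolding right_tree_def box_count_shift by (rule par_graph_shift) simp

lemma left_tree_shift: "left_tree (shift_points n C) = shift_graph n (left_tree C)"
proof -
  have "left_tree (shift_points n C) = par_graph uminus (\<lambda>i. box_count C (True, - (i - (- n))))"
    by (simp add: left_tree_def box_count_shift)
  also have "\<dots> = shift_graph n (left_tree C)"
    unfolding left_tree_def by (rule par_graph_shift) simp
  finally show ?thesis .
qed

text \<open>Each tree is a measurable function of the counts in its own strip, and the strips are
  disjoint index sets of an independent family.\<close>

lemma indep_trees:
  assumes M: "prob_space M" and P: "poisson_process M 1 half_plane \<P>"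
  shows "prob_space.indep_var M int_graph_space (\<lambda>\<omega>. right_tree (\<P> \<omega>))
      int_graph_space (\<lambda>\<omega>. left_tree (\<P> \<omega>))"
    and "prob_space.indep_var M int_graph_space (\<lambda>\<omega>. left_tree (\<P> \<omega>))
      int_graph_space (\<lambda>\<omega>. right_tree (\<P> \<omega>))"
proof -
  interpret prob_space M by (rule M)
  let ?A = "{False} \<times> (UNIV :: int set)" and ?B = "{True} \<times> (UNIV :: int set)"
  let ?N = "\<lambda>A. Pi\<^sub>M A (\<lambda>_ :: bool \<times> int. count_space (UNIV :: nat set))"
  let ?Z = "\<lambda>A \<omega>. restrict (\<lambda>x. box_count (\<P> \<omega>) x) A"
  let ?R = "\<lambda>z :: bool \<times> int \<Rightarrow> nat. par_graph id (\<lambda>i. z (False, i))"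
    and ?L = "\<lambda>z :: bool \<times> int \<Rightarrow> nat. par_graph uminus (\<lambda>i. z (True, - i))"
  have R: "?R \<in> ?N ?A \<rightarrow>\<^sub>M int_graph_space" and L: "?L \<in> ?N ?B \<rightarrow>\<^sub>M int_graph_space"
    by (auto intro!: measurable_par_graph measurable_component_singleton)
  note ind = indep_var_restrict[OF indep_box_counts[OF M P]]
  have "?R \<circ> ?Z ?A = (\<lambda>\<omega>. right_tree (\<P> \<omega>))" "?L \<circ> ?Z ?B = (\<lambda>\<omega>. left_tree (\<P> \<omega>))"
    by (simp_all add: fun_eq_iff right_tree_def left_tree_def)
  then show "indep_var int_graph_space (\<lambda>\<omega>. right_tree (\<P> \<omega>)) int_graph_space (\<lambda>\<omega>. left_tree (\<P> \<omega>))"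
    and "indep_var int_graph_space (\<lambda>\<omega>. left_tree (\<P> \<omega>)) int_graph_space (\<lambda>\<omega>. right_tree (\<P> \<omega>))"
    using indep_var_compose[OF ind R L] indep_var_compose[OF ind L R] by auto
qed

text \<open>Walk positions 0 and 1 are adjacent iff position 1 is not a leaf. This supplies the
  event of nontrivial probability for \<open>not_factor_of_indep\<close>.\<close>

lemma par_graph_edge_prob:
  assumes M: "prob_space M" and X: "pois_family M X" and g: "\<And>x. g (g x) = x"
  shows "measure M ((\<lambda>\<omega>. par_graph g (\<lambda>i. X i \<omega>)) -` {G \<in> int_graphs. {g 0, g 1} \<in> edges G} \<inter> space M) =
    1 - exp (- 1)"
proof -
  interpret prob_space M by (rule M)
  have 01: "par \<xi> 0 1 \<longleftrightarrow> \<xi> 1 \<noteq> 0" "\<not> par \<xi> 1 0" for \<xi>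
  proof -
    have "{0<..1::int} = {1}" by auto
    then show "par \<xi> 0 1 \<longleftrightarrow> \<xi> 1 \<noteq> 0" by (auto simp: par_def rise_def)
  qed (simp add: par_def)
  have "par_graph g \<xi> \<in> int_graphs" for \<xi>
    using simple_par_graph[OF g] by (simp add: int_graphs_def)
  then have "(\<lambda>\<omega>. par_graph g (\<lambda>i. X i \<omega>)) -` {G \<in> int_graphs. {g 0, g 1} \<in> edges G} \<inter> space M =
      space M - {\<omega> \<in> space M. \<forall>y\<in>{1}. X y \<omega> = 0}"
    by (auto simp: edges_par_graph[OF g] g 01)
  moreover have "{\<omega> \<in> space M. \<forall>y\<in>{1}. X y \<omega> = 0} \<in> events"
    "prob {\<omega> \<in> space M. \<forall>y\<in>{1}. X y \<omega> = 0} = (\<Prod>y\<in>{1::int}. pois 0)"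
    using X[unfolded pois_family_def, rule_format, of "{1}" "\<lambda>_. 0"] by blast+
  ultimately show ?thesis by (simp add: prob_compl)
qed

theorem theorem1:
  fixes M :: "'a measure" and \<P> :: "'a \<Rightarrow> (real \<times> real) set"
  assumes "prob_space M"
    and "poisson_process M 1 half_plane \<P>"
  shows "\<exists>T T' :: (real \<times> real) set \<Rightarrow> int graph.
    T \<in> config_space half_plane \<rightarrow>\<^sub>M int_graph_space \<and>
    T' \<in> config_space half_plane \<rightarrow>\<^sub>M int_graph_space \<and>
    (AE \<omega> in M. is_tree (T (\<P> \<omega>))) \<and>
    (AE \<omega> in M. is_tree (T' (\<P> \<omega>))) \<and>
    (AE \<omega> in M. T (\<P> \<omega>) \<noteq> T' (\<P> \<omega>)) \<and>
    (AE \<omega> in M. \<forall>v. \<exists>!p. infinite_path_from (T (\<P> \<omega>)) v p \<and> rightward p) \<and>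
    (AE \<omega> in M. \<forall>v. \<exists>!p. infinite_path_from (T' (\<P> \<omega>)) v p \<and> leftward p) \<and>
    \<not> is_factor_of M int_graph_space (\<lambda>\<omega>. T (\<P> \<omega>)) int_graph_space (\<lambda>\<omega>. T' (\<P> \<omega>)) \<and>
    \<not> is_factor_of M int_graph_space (\<lambda>\<omega>. T' (\<P> \<omega>)) int_graph_space (\<lambda>\<omega>. T (\<P> \<omega>)) \<and>
    (\<forall>U \<in> {T, T'}.
      (\<forall>n. \<forall>C \<in> configurations half_plane. U (shift_points n C) = shift_graph n (U C)) \<and>
      (\<forall>n. same_local_law M (\<lambda>\<omega>. (U (\<P> \<omega>), n)) iic_measure iic_rooted))"
proof -
  define X where "X i \<omega> = box_count (\<P> \<omega>) (False, i)" for i \<omega>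
  define Y where "Y i \<omega> = box_count (\<P> \<omega>) (True, - i)" for i \<omega>
  have T: "right_tree (\<P> \<omega>) = par_graph id (\<lambda>i. X i \<omega>)" for \<omega>
    by (simp add: right_tree_def X_def)
  have T': "left_tree (\<P> \<omega>) = par_graph uminus (\<lambda>i. Y i \<omega>)" for \<omega>
    by (simp add: left_tree_def Y_def)
  have X: "pois_family M X" and Y: "pois_family M Y"
    unfolding X_def Y_def
    using pois_family_box_counts[OF assms, of "\<lambda>i. (False, i)"]
      pois_family_box_counts[OF assms, of "\<lambda>i::int. (True, - i)"] by (auto simp: inj_def)
  have "\<P> \<in> M \<rightarrow>\<^sub>M config_space half_plane" using assms(2) by (simp add: poisson_process_def)
  then have XY: "X i \<in> M \<rightarrow>\<^sub>M count_space UNIV" "Y i \<in> M \<rightarrow>\<^sub>M count_space UNIV" for i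
    unfolding X_def Y_def by (auto intro: measurable_compose measurable_box_count)
  note XE = AE_par_exists[OF assms(1) X] and YE = AE_par_exists[OF assms(1) Y]
  have exp1: "1 - exp (- 1) \<notin> {0, 1 :: real}" by simp
  have "right_tree \<in> config_space half_plane \<rightarrow>\<^sub>M int_graph_space"
    unfolding right_tree_def by (intro measurable_par_graph measurable_box_count) simp
  moreover have "left_tree \<in> config_space half_plane \<rightarrow>\<^sub>M int_graph_space"
    unfolding left_tree_def by (intro measurable_par_graph measurable_box_count) simp
  moreover have "AE \<omega> in M. is_tree (right_tree (\<P> \<omega>))"
    using XE(1) unfolding T by (rule AE_mp) (auto intro!: is_tree_par_graph)
  moreover have "AE \<omega> in M. is_tree (left_tree (\<P> \<omega>))"
    using YE(1) unfolding T' by (rule AE_mp) (auto intro!: is_tree_par_graph)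
  moreover have "AE \<omega> in M. right_tree (\<P> \<omega>) \<noteq> left_tree (\<P> \<omega>)"
    using XE(2) YE(1)
  proof eventually_elim
    case (elim \<omega>)
    then obtain v where "X v \<omega> = 0" by blast
    then show ?case
      unfolding T T' using par_graph_neq[of "\<lambda>i. X i \<omega>" v "\<lambda>i. Y i \<omega>"] elim by blast
  qed
  moreover have "AE \<omega> in M. \<forall>v. \<exists>!p. infinite_path_from (right_tree (\<P> \<omega>)) v p \<and> rightward p"
    using XE(1)
  proof eventually_elim
    case (elim \<omega>)
    then show ?case using unique_infinite_path[of id "\<lambda>i. X i \<omega>"] by (simp add: T)
  qed
  moreover have "AE \<omega> in M. \<forall>v. \<exists>!p. infinite_path_from (left_tree (\<P> \<omega>)) v p \<and> leftward p"
    using YE(1)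
  proof eventually_elim
    case (elim \<omega>)
    have "leftward p \<longleftrightarrow> rightward (uminus \<circ> p)" for p
      by (simp add: leftward_def rightward_def)
    with elim show ?case using unique_infinite_path[of uminus "\<lambda>i. Y i \<omega>"] by (simp add: T')
  qed
  moreover have "\<not> is_factor_of M int_graph_space (\<lambda>\<omega>. right_tree (\<P> \<omega>))
      int_graph_space (\<lambda>\<omega>. left_tree (\<P> \<omega>))"
    using exp1 par_graph_edge_prob[OF assms(1) X, of id]
    by (intro not_factor_of_indep[OF assms(1) indep_trees(1)[OF assms] edge_event_int_graph_space[of "id 0" "id 1"]])
      (simp add: T)
  moreover have "\<not> is_factor_of M int_graph_space (\<lambda>\<omega>. left_tree (\<P> \<omega>))
      int_graph_space (\<lambda>\<omega>. right_tree (\<P> \<omega>))"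
    using exp1 par_graph_edge_prob[OF assms(1) Y, of uminus]
    by (intro not_factor_of_indep[OF assms(1) indep_trees(2)[OF assms] edge_event_int_graph_space[of "- 0" "- 1"]])
      (simp add: T')
  moreover have "same_local_law M (\<lambda>\<omega>. (right_tree (\<P> \<omega>), n)) iic_measure iic_rooted" for n
    unfolding T by (rule par_graph_local_law[OF assms(1) X XY(1)]) simp
  moreover have "same_local_law M (\<lambda>\<omega>. (left_tree (\<P> \<omega>), n)) iic_measure iic_rooted" for n
    unfolding T' by (rule par_graph_local_law[OF assms(1) Y XY(2)]) simp
  ultimately show ?thesis
    using right_tree_shift left_tree_shift by (intro exI[of _ right_tree] exI[of _ left_tree]) simp
qed

end
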